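(* Let $g\ge 0$, $n\ge 1$ be integers with $2g-2+n\ge 2$, and let $b\ge 0$ and $\mathbf b=(b_1,\dots,b_{n-1})$ with all $b_j\ge 0$. Then the Weil–Petersson volume polynomials satisfy $$\frac{1}{4\pi i}\Big((b+2\pi i)V_{g,n}(b+2\pi i,\mathbf b)-(b-2\pi i)V_{g,n}(b-2\pi i,\mathbf b)\Big)=\frac12\iint_{b',b''\ge 0,\ b'+b''\le b} b'b''V_{g-1,n+1}(b',b'',\mathbf b)\,db'\,db''$$ $$+\frac12\sum_{\substack{g_1+g_2=g\\ \mathbf b_1\sqcup\mathbf b_2=\mathbf b}}\iint_{b',b''\ge 0,\ b'+b''\le b} b'b''V_{g_1,n_1}(b',\mathbf b_1)V_{g_2,n_2}(b'',\mathbf b_2)\,db'\,db''+\frac12\sum_{j=1}^{n-1}\left(\int_0^{b+b_j}+\int_0^{b-b_j}\right)b'V_{g,n-1}(b',\mathbf b\setminus b_j)\,db'.$$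
   Context: For $g\ge0$, $n\ge1$, $2g-2+n\ge1$, $V_{g,n}(b_1,\dots,b_n)$ denotes the Weil–Petersson volume of the moduli space $\mathcal M_{g,n}(b_1,\dots,b_n)$ of hyperbolic surfaces of genus $g$ with $n$ labelled geodesic boundary components of lengths $b_1,\dots,b_n$ (volume form induced by $\omega=\sum_i dl_i\wedge d\tau_i$ in Fenchel–Nielsen coordinates), with the convention that $V_{1,1}$ is half of the volume. So $V_{0,3}=1$, $V_{1,1}(b)=\frac1{48}(b^2+4\pi^2)$. It is known that $V_{g,n}$ is a symmetric polynomial, even in each variable, so it makes sense at complex arguments. It is also known (Mirzakhani) that for $2g-2+n\ge2$ and $b,b_j\ge 0$, $$\frac{\partial}{\partial b}\big(bV_{g,n}(b,\mathbf b)\big)=\frac12\int_0^\infty\!\!\int_0^\infty b'b''V_{g-1,n+1}(b',b'',\mathbf b)H(b'+b'',b)\,db'db''+\frac12\sum_{\substack{g_1+g_2=g\\ \mathbf b_1\sqcup\mathbf b_2=\mathbf b}}\int_0^\infty\!\!\int_0^\infty b'b''V_{g_1,n_1}(b',\mathbf b_1)V_{g_2,n_2}(b'',\mathbf b_2)H(b'+b'',b)\,db'db''+\frac12\sum_{j=1}^{n-1}\int_0^\infty b'V_{g,n-1}(b',\mathbf b\setminus b_j)\big(H(b',b+b_j)+H(b',b-b_j)\big)db',$$ where $H(x,y)=(1+e^{(x+y)/2})^{-1}+(1+e^{(x-y)/2})^{-1}$; together with the initial values this determines all $V_{g,n}$. Conventions: $\mathbf b\setminus b_j$ is $\mathbf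 b$ with $b_j$ removed; the sum over $g_1+g_2=g$, $\mathbf b_1\sqcup\mathbf b_2=\mathbf b$ runs over ordered pairs of nonnegative integers and ordered set partitions, with $n_i=|\mathbf b_i|+1$; any term containing a $V_{g',n'}$ with $g'<0$ or $2g'-2+n'\le 0$ is zero. Integrals $\int_0^{b-b_j}$ are oriented. *)

theory Defs
  imports "HOL-Analysis.Analysis"
begin

text \<open>
  The volumes are encoded as one function \<open>V\<close> of the genus and of the list of boundary lengths,
  so that \<open>V g [b\<^sub>1, \<dots>, b\<^sub>n]\<close> stands for the volume polynomial \<open>V\<^bsub>g,n\<^esub>(b\<^sub>1, \<dots>, b\<^sub>n)\<close> at complex
  arguments. For a list \<open>bs\<close> of length \<open>m\<close>, an ordered partition of \<open>bs\<close> into two parts is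
  given by a set \<open>I \<subseteq> {..<m}\<close> of positions, the parts being \<open>nths bs I\<close> and
  \<open>nths bs ({..<m} - I)\<close>.
\<close>

definition mirzakhani_H :: "real \<Rightarrow> real \<Rightarrow> real" where
  "mirzakhani_H x y = 1 / (1 + exp ((x + y) / 2)) + 1 / (1 + exp ((x - y) / 2))"

definition polynomial_in :: "nat \<Rightarrow> (complex list \<Rightarrow> complex) \<Rightarrow> bool" where
  "polynomial_in n f \<longleftrightarrow>
     (\<exists>(E :: (nat \<Rightarrow> nat) set) c. finite E \<and>
        (\<forall>zs. length zs = n \<longrightarrow> f zs = (\<Sum>e\<in>E. c e * (\<Prod>i<n. zs ! i ^ e i))))"

definition even_in_each_variable :: "nat \<Rightarrow> (complex list \<Rightarrow> complex) \<Rightarrow> bool" where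
  "even_in_each_variable n f \<longleftrightarrow>
     (\<forall>zs i. length zs = n \<longrightarrow> i < n \<longrightarrow> f (zs[i := - (zs ! i)]) = f zs)"

text \<open>
  The right-hand side of Mirzakhani's recursion for \<open>V\<^bsub>g,n\<^esub>(b, bs)\<close>, where \<open>bs\<close> has length
  \<open>n - 1\<close>. The case distinction on \<open>g = 0\<close> is the convention that a volume of negative genus
  is zero (\<open>g - 1\<close> would be truncated).
\<close>

definition mirzakhani_rhs ::
    "(nat \<Rightarrow> complex list \<Rightarrow> complex) \<Rightarrow> nat \<Rightarrow> real \<Rightarrow> real list \<Rightarrow> complex" where
  "mirzakhani_rhs V g b bs =
     1/2 * (if g = 0 then 0 else
        (LINT x:{0..}|lborel. LINT y:{0..}|lborel.
           complex_of_real (x * y) * V (g - 1) (map of_real (x # y # bs))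
             * of_real (mirzakhani_H (x + y) b)))
   + 1/2 * (\<Sum>g1\<le>g. \<Sum>I\<in>Pow {..<length bs}.
        (LINT x:{0..}|lborel. LINT y:{0..}|lborel.
           complex_of_real (x * y) * V g1 (map of_real (x # nths bs I))
             * V (g - g1) (map of_real (y # nths bs ({..<length bs} - I)))
             * of_real (mirzakhani_H (x + y) b)))
   + 1/2 * (\<Sum>j<length bs.
        (LINT x:{0..}|lborel.
           complex_of_real x * V g (map of_real (x # nths bs (- {j})))
             * of_real (mirzakhani_H x (b + bs ! j) + mirzakhani_H x (b - bs ! j))))"

text \<open>
  The properties of the Weil--Petersson volumes that determine them. The Riemannian-geometric
  definition via moduli spaces is not available in the libraries; by Mirzakhani's theorem the
  volumes of the moduli spaces are the unique family described here. The recursion only speaks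
  about nonnegative real lengths, and polynomiality then fixes the values at complex arguments.
  Symmetry in the boundary lengths is not listed because it is a consequence. The first clause
  is the convention for unstable \<open>(g, n)\<close>, and gives the value 0 to \<open>V\<^bsub>g,0\<^esub>\<close>, which
  occurs nowhere else.
\<close>

definition weil_petersson_family :: "(nat \<Rightarrow> complex list \<Rightarrow> complex) \<Rightarrow> bool" where
  "weil_petersson_family V \<longleftrightarrow>
     (\<forall>g zs. zs = [] \<or> 2 * int g - 2 + int (length zs) \<le> 0 \<longrightarrow> V g zs = 0) \<and>
     (\<forall>g n. polynomial_in n (V g) \<and> even_in_each_variable n (V g)) \<and>
     (\<forall>z1 z2 z3. V 0 [z1, z2, z3] = 1) \<and>
     (\<forall>z. V 1 [z] = (z\<^sup>2 + 4 * of_real pi ^ 2) / 48) \<and>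
     (\<forall>g b bs. 2 * int g - 2 + int (length (b # bs)) \<ge> 2 \<longrightarrow> b \<ge> 0 \<longrightarrow> (\<forall>x\<in>set bs. x \<ge> 0) \<longrightarrow>
        ((\<lambda>t. of_real t * V g (map of_real (t # bs)))
           has_vector_derivative mirzakhani_rhs V g b bs) (at b within {0..}))"

definition WP_volume :: "nat \<Rightarrow> complex list \<Rightarrow> complex" where
  "WP_volume = (THE V. weil_petersson_family V)"

end

theory Submission
  imports Defs "HOL-Complex_Analysis.Complex_Analysis" "HOL-Real_Asymp.Real_Asymp"
begin

text \<open>
  The right-hand side of the recursion is linear in the volumes of lower complexity, and a double
  integral of \<open>x\<^sup>p y\<^sup>q \<phi>(x + y)\<close> is a Beta constant times the single integral of
  \<open>s\<^bsup>p+q+1\<^esup> \<phi>(s)\<close>, both for \<open>\<phi> = H(\<cdot>, b)\<close> and for \<open>\<phi> = 1\<^bsub>[0,b]\<^esub>\<close>. So everything reduces to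
  one statement about odd monomials: the function \<open>b \<mapsto> \<integral> x\<^bsup>2d+1\<^esup> H(x, b) dx\<close> has an odd polynomial
  primitive \<open>P\<close> with \<open>P(z + 2\<pi>i) - P(z - 2\<pi>i) = 4\<pi>i z\<^bsup>2d+2\<^esup> / (2d + 2)\<close>. Shifting the variable expresses
  \<open>P\<close> by moments of \<open>f(u) = 1 / (1 + e\<^bsup>u/2\<^esup>)\<close>, and since \<open>1 - e\<^bsup>z/2\<^esup>\<close> at \<open>z = u \<plusminus> 2\<pi>i\<close> is
  \<open>1 + e\<^bsup>u/2\<^esup>\<close>, the difference equation is Cauchy's theorem in a half strip.

  As the volumes are given by a definite description, the existence and uniqueness of the family
  are part of the proof. In the recursion the first variable is distinguished and evenness in every
  variable is preserved, so existence needs no symmetry of the polynomials.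
\<close>

section \<open>Even polynomials in several variables\<close>

text \<open>The identity and the existence of the family come out of one construction. For an
  arbitrary family of even polynomials, the terms of the recursion yield a polynomial W such that b
  W(b) has the recursion's right-hand side as its derivative and the right-hand side claimed here as
  its shifted difference. Applied level by level this builds the volumes; applied to the finished
  volumes it gives a W that uniqueness identifies with them. The Fermi moments drop out of the
  difference equation and the Beta constants are common to both sides, so neither is evaluated.

  Two points shape the details. The recursion determines b V rather than V, so each primitive must
  be divisible by b with a quotient even in all variables. Hence P is taken odd and enters through
  P(z + w) + P(z - w), with w = 0 for the double integrals and w = b_j for the others. Moreover b -
  b_j may be negative, so the moment formula and the difference equation must hold at all real
  arguments, with oriented integrals.\<close>

text \<open>Generating by squares makes closure properties short inductions without exponent
  bookkeeping. The rule \<open>cong\<close> ties the notion to lists of length \<open>n\<close>;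
  values at other lengths are unconstrained.\<close>

inductive even_poly :: "nat \<Rightarrow> (complex list \<Rightarrow> complex) \<Rightarrow> bool" for n where
  const: "even_poly n (\<lambda>_. c)"
| square: "j < n \<Longrightarrow> even_poly n (\<lambda>zs. (zs ! j)\<^sup>2)"
| add: "even_poly n f \<Longrightarrow> even_poly n g \<Longrightarrow> even_poly n (\<lambda>zs. f zs + g zs)"
| mult: "even_poly n f \<Longrightarrow> even_poly n g \<Longrightarrow> even_poly n (\<lambda>zs. f zs * g zs)"
| cong: "even_poly n f \<Longrightarrow> (\<And>zs. length zs = n \<Longrightarrow> g zs = f zs) \<Longrightarrow> even_poly n g"

lemmas even_poly_intros = even_poly.const even_poly.square even_poly.add even_poly.mult

lemma even_poly_sum:
  "(\<And>k. k \<in> K \<Longrightarrow> even_poly n (f k)) \<Longrightarrow> even_poly n (\<lambda>zs. \<Sum>k\<in>K. f k zs)"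
  by (induction K rule: infinite_finite_induct) (auto intro: even_poly_intros)

lemma even_poly_power: "even_poly n f \<Longrightarrow> even_poly n (\<lambda>zs. f zs ^ k)"
  by (induction k) (auto intro: even_poly_intros)

lemma even_poly_even_power: "j < n \<Longrightarrow> even_poly n (\<lambda>zs. (zs ! j) ^ (2 * k))"
  unfolding power_mult by (intro even_poly_power even_poly.square)

text \<open>Only squares of variables occur in \<open>f\<close>, so the entries of
  \<open>h zs\<close> matter through their squares alone: an entry may be a coordinate or a constant
  such as 0.\<close>

lemma even_poly_compose:
  assumes "even_poly m f"
    and len: "\<And>zs. length zs = n \<Longrightarrow> length (h zs) = m"
    and sq: "\<And>i. i < m \<Longrightarrow> even_poly n (\<lambda>zs. (h zs ! i)\<^sup>2)"
  shows "even_poly n (\<lambda>zs. f (h zs))"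
  using assms(1)
proof induction
  case (square j)
  then show ?case
    by (rule sq)
next
  case (cong f g)
  show ?case
    by (rule even_poly.cong[OF cong.IH]) (simp add: cong.hyps len)
qed (auto intro: even_poly_intros)

lemma even_poly_reindex:
  assumes "even_poly m f"
    and "\<And>zs. length zs = n \<Longrightarrow> length (h zs) = m"
    and "\<And>zs i. length zs = n \<Longrightarrow> i < m \<Longrightarrow> h zs ! i = zs ! \<sigma> i"
    and "\<And>i. i < m \<Longrightarrow> \<sigma> i < n"
  shows "even_poly n (\<lambda>zs. f (h zs))"
  using assms(1,2)
proof (rule even_poly_compose)
  show "even_poly n (\<lambda>zs. (h zs ! i)\<^sup>2)" if "i < m" for i
    by (rule even_poly.cong[OF even_poly.square[OF assms(4)[OF that]]]) (simp add: assms(3) that)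
qed

lemma even_poly_tl: "even_poly n f \<Longrightarrow> even_poly (Suc n) (\<lambda>zs. f (tl zs))"
  by (rule even_poly_reindex[where \<sigma> = Suc]) (auto simp: nth_tl)

lemma even_poly_continuous:
  assumes "even_poly n f" and "\<And>i. i < n \<Longrightarrow> continuous_on S (\<lambda>x. h x ! i)" and "\<And>x. length (h x) = n"
  shows "continuous_on S (\<lambda>x. f (h x))"
  using assms(1)
  by induction (use assms(2,3) in \<open>auto intro!: continuous_intros\<close>)

text \<open>Terms are kept in a list, so that sums are appended and products formed pairwise with
  repeated degrees allowed.\<close>

lemma even_poly_Suc_expand:
  assumes "even_poly (Suc n) f"
  shows "\<exists>L. (\<forall>(a, d)\<in>set L. even_poly n a) \<and>
    (\<forall>z zs. length zs = n \<longrightarrow> f (z # zs) = (\<Sum>(a, d)\<leftarrow>L. a zs * z ^ (2 * d)))"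
  using assms
proof induction
  case (const c)
  show ?case
    by (rule exI[of _ "[(\<lambda>_. c, 0)]"]) (auto intro: even_poly_intros)
next
  case (square j)
  show ?case
  proof (cases j)
    case 0
    then show ?thesis
      by (intro exI[of _ "[(\<lambda>_. 1, 1)]"]) (auto intro: even_poly_intros)
  next
    case (Suc i)
    with square show ?thesis
      by (intro exI[of _ "[(\<lambda>zs. (zs ! i)\<^sup>2, 0)]"]) (auto intro: even_poly_intros)
  qed
next
  case (add f g)
  then obtain L L' where
    "\<forall>(a, d)\<in>set L. even_poly n a" "\<forall>(a, d)\<in>set L'. even_poly n a"
    "\<forall>z zs. length zs = n \<longrightarrow> f (z # zs) = (\<Sum>(a, d)\<leftarrow>L. a zs * z ^ (2 * d))"
    "\<forall>z zs. length zs = n \<longrightarrow> g (z # zs) = (\<Sum>(a, d)\<leftarrow>L'. a zs * z ^ (2 * d))"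
    by blast
  then show ?case
    by (intro exI[of _ "L @ L'"]) auto
next
  case (mult f g)
  then obtain L L' where L:
    "\<forall>(a, d)\<in>set L. even_poly n a" "\<forall>(a, d)\<in>set L'. even_poly n a"
    "\<forall>z zs. length zs = n \<longrightarrow> f (z # zs) = (\<Sum>(a, d)\<leftarrow>L. a zs * z ^ (2 * d))"
    "\<forall>z zs. length zs = n \<longrightarrow> g (z # zs) = (\<Sum>(a, d)\<leftarrow>L'. a zs * z ^ (2 * d))"
    by blast
  define P where "P = (\<lambda>(a, d :: nat). map (\<lambda>(a', d'). (\<lambda>zs. a zs * a' zs :: complex, d + d')) L')"
  have single: "(\<Sum>(a, d)\<leftarrow>P (a, d). a zs * z ^ (2 * d))
      = a zs * z ^ (2 * d) * (\<Sum>(a, d)\<leftarrow>L'. a zs * z ^ (2 * d))" for a d z zs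
    unfolding P_def by (induction L') (auto simp: algebra_simps power_add)
  have "(\<Sum>(a, d)\<leftarrow>concat (map P L). a zs * z ^ (2 * d))
      = (\<Sum>(a, d)\<leftarrow>L. a zs * z ^ (2 * d)) * (\<Sum>(a, d)\<leftarrow>L'. a zs * z ^ (2 * d))" for z zs
  proof (induction L)
    case (Cons p L)
    then show ?case
      by (cases p) (simp add: single distrib_right)
  qed simp
  moreover have "\<forall>(a, d)\<in>set (concat (map P L)). even_poly n a"
    using L(1,2) by (fastforce simp: P_def intro: even_poly.mult)
  ultimately show ?case
    using L by (intro exI[of _ "concat (map P L)"]) auto
next
  case (cong f g)
  then show ?case
    by auto
qed

text \<open>The linearity principle behind all later reductions: an additive property that sees only
  lists of length \<open>Suc n\<close> has to be checked only for one even power of the first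
  variable with a coefficient in the others.\<close>

lemma even_poly_Suc_induct [consumes 1, case_names monomial add cong]:
  assumes "even_poly (Suc n) f"
    and monomial: "\<And>a d. even_poly n a \<Longrightarrow> P (\<lambda>zs. a (tl zs) * hd zs ^ (2 * d))"
    and add: "\<And>f g. P f \<Longrightarrow> P g \<Longrightarrow> P (\<lambda>zs. f zs + g zs)"
    and cong: "\<And>f g. P f \<Longrightarrow> (\<And>z zs. length zs = n \<Longrightarrow> g (z # zs) = f (z # zs)) \<Longrightarrow> P g"
  shows "P f"
proof -
  obtain L where L: "\<forall>(a, d)\<in>set L. even_poly n a"
    "\<And>z zs. length zs = n \<Longrightarrow> f (z # zs) = (\<Sum>(a, d)\<leftarrow>L. a zs * z ^ (2 * d))"
    using even_poly_Suc_expand[OF assms(1)] by blast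
  from L(1) have "P (\<lambda>zs. \<Sum>(a, d)\<leftarrow>L. a (tl zs) * hd zs ^ (2 * d))"
  proof (induction L)
    case Nil
    show ?case
      using monomial[OF even_poly.const[of n 0], of 0] by simp
  next
    case (Cons p L)
    obtain a d where p: "p = (a, d)"
      by (cases p)
    show ?case
      using add[OF monomial[of a d] Cons.IH] Cons.prems by (simp add: p)
  qed
  then show ?thesis
    by (rule cong) (simp add: L(2))
qed

section \<open>Comparison with \<open>polynomial_in\<close>, and the identity theorem\<close>

text \<open>\<open>polynomial_in\<close> sums over a set of exponents, whereas sums and products
  produce the same exponent repeatedly; collecting coefficients along the fibres of \<open>e\<close>
  merges the repetitions.\<close>

lemma polynomial_in_indexed:
  assumes "finite K" and f: "\<And>zs. length zs = n \<Longrightarrow> f zs = (\<Sum>k\<in>K. c k * (\<Prod>i<n. zs ! i ^ e k i))"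
  shows "polynomial_in n f"
  unfolding polynomial_in_def
proof (intro exI conjI allI impI)
  show "finite (e ` K)"
    using assms(1) by simp
  fix zs :: "complex list"
  assume "length zs = n"
  then have "f zs = (\<Sum>d\<in>e ` K. \<Sum>k\<in>{k \<in> K. e k = d}. c k * (\<Prod>i<n. zs ! i ^ e k i))"
    by (simp add: f sum.image_gen[OF assms(1), of _ e])
  also have "\<dots> = (\<Sum>d\<in>e ` K. (\<Sum>k\<in>{k \<in> K. e k = d}. c k) * (\<Prod>i<n. zs ! i ^ d i))"
    by (intro sum.cong refl) (auto simp: sum_distrib_right)
  finally show "f zs = (\<Sum>d\<in>e ` K. (\<Sum>k\<in>{k \<in> K. e k = d}. c k) * (\<Prod>i<n. zs ! i ^ d i))" .
qed

lemma even_poly_imp_polynomial_in: "even_poly n f \<Longrightarrow> polynomial_in n f"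
proof (induction rule: even_poly.induct)
  case (const c)
  show ?case
    by (rule polynomial_in_indexed[of "{()}" _ _ "\<lambda>_. c" "\<lambda>_ _. 0"]) auto
next
  case (square j)
  have "(zs ! j)\<^sup>2 = (\<Prod>i<n. zs ! i ^ (if i = j then 2 else 0))" for zs :: "complex list"
    using square by (simp add: if_distrib[of "power _"] prod.delta' cong: if_cong)
  then show ?case
    by (intro polynomial_in_indexed[of "{()}" _ _ "\<lambda>_. 1" "\<lambda>_ i. if i = j then 2 else 0"]) auto
next
  case (add f g)
  then obtain E c E' c' where *: "finite E" "finite E'"
    "\<forall>zs. length zs = n \<longrightarrow> f zs = (\<Sum>e\<in>E. c e * (\<Prod>i<n. zs ! i ^ e i))"
    "\<forall>zs. length zs = n \<longrightarrow> g zs = (\<Sum>e\<in>E'. c' e * (\<Prod>i<n. zs ! i ^ e i))"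
    unfolding polynomial_in_def by blast
  show ?case
    by (rule polynomial_in_indexed[of "E <+> E'" _ _ "case_sum c c'" "case_sum id id"])
      (use * in \<open>auto simp: sum.Plus\<close>)
next
  case (mult f g)
  then obtain E c E' c' where *: "finite E" "finite E'"
    "\<forall>zs. length zs = n \<longrightarrow> f zs = (\<Sum>e\<in>E. c e * (\<Prod>i<n. zs ! i ^ e i))"
    "\<forall>zs. length zs = n \<longrightarrow> g zs = (\<Sum>e\<in>E'. c' e * (\<Prod>i<n. zs ! i ^ e i))"
    unfolding polynomial_in_def by blast
  show ?case
    by (rule polynomial_in_indexed[of "E \<times> E'" _ _ "\<lambda>(e, e'). c e * c' e'" "\<lambda>(e, e') i. e i + e' i"])
      (use * in \<open>auto simp: sum_product sum.cartesian_product power_add prod.distrib case_prod_unfold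
        intro!: sum.cong\<close>)
next
  case (cong f g)
  then show ?case
    by (simp add: polynomial_in_def)
qed

lemma even_poly_imp_even: "even_poly n f \<Longrightarrow> even_in_each_variable n f"
proof (induction rule: even_poly.induct)
  case (square j)
  then show ?case
    by (auto simp: even_in_each_variable_def nth_list_update)
qed (auto simp: even_in_each_variable_def)

lemma polynomial_in_update:
  assumes "polynomial_in n f" "length zs = n" "i < n"
  shows "\<exists>p. \<forall>z. f (zs[i := z]) = poly p z"
proof -
  obtain E c where E: "finite E"
    "\<forall>zs. length zs = n \<longrightarrow> f zs = (\<Sum>e\<in>E. c e * (\<Prod>j<n. zs ! j ^ e j))"
    using assms(1) unfolding polynomial_in_def by blast
  have "(\<Prod>j<n. zs[i := z] ! j ^ e j) = (\<Prod>j\<in>{..<n} - {i}. zs ! j ^ e j) * z ^ e i" for e z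
    using assms(2,3) by (subst prod.remove[of _ i]) (auto simp: mult.commute intro!: prod.cong)
  then show ?thesis
    using assms E
    by (intro exI[of _ "\<Sum>e\<in>E. monom (c e * (\<Prod>j\<in>{..<n} - {i}. zs ! j ^ e j)) (e i)"])
      (simp add: poly_sum poly_monom mult.assoc)
qed

text \<open>The variables are freed one at a time: with the others fixed, both sides are polynomials
  in one variable that agree at infinitely many points.\<close>

lemma polynomial_in_eqI:
  assumes f: "polynomial_in n f" and g: "polynomial_in n g"
    and eq: "\<And>xs. length xs = n \<Longrightarrow> \<forall>x\<in>set xs. x > 0 \<Longrightarrow> f (map of_real xs) = g (map of_real xs)"
    and "length zs = n"
  shows "f zs = g zs"
proof -
  \<comment> \<open>At stage \<open>k\<close> the first \<open>k\<close> entries are arbitrary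
    complex numbers and the remaining ones are still positive reals.\<close>
  have "\<forall>zs. length zs = n \<longrightarrow> (\<forall>i. k \<le> i \<longrightarrow> i < n \<longrightarrow> (\<exists>x>0. zs ! i = of_real x)) \<longrightarrow> f zs = g zs"
    if "k \<le> n" for k
    using that
  proof (induction k)
    case 0
    show ?case
    proof (intro allI impI)
      fix zs :: "complex list"
      assume zs: "length zs = n" "\<forall>i. 0 \<le> i \<longrightarrow> i < n \<longrightarrow> (\<exists>x>0. zs ! i = of_real x)"
      define xs where "xs = map Re zs"
      have "zs = map of_real xs"
        using zs by (auto simp: xs_def list_eq_iff_nth_eq)
      moreover have "\<forall>x\<in>set xs. x > 0"
        using zs by (fastforce simp: xs_def in_set_conv_nth)
      ultimately show "f zs = g zs"
        using eq[of xs] zs(1) by simp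
    qed
  next
    case (Suc k)
    show ?case
    proof (intro allI impI)
      fix zs :: "complex list"
      assume zs: "length zs = n" "\<forall>i. Suc k \<le> i \<longrightarrow> i < n \<longrightarrow> (\<exists>x>0. zs ! i = of_real x)"
      obtain p q where pq: "\<And>z. f (zs[k := z]) = poly p z" "\<And>z. g (zs[k := z]) = poly q z"
        using polynomial_in_update[OF f zs(1), of k] polynomial_in_update[OF g zs(1), of k] Suc.prems
        by auto
      have "f (zs[k := of_real x]) = g (zs[k := of_real x])" if "x > 0" for x :: real
        using Suc zs that by (simp add: nth_list_update)
      then have "of_real ` {0<..} \<subseteq> {z. poly (p - q) z = 0}"
        using pq by auto
      moreover have "infinite (of_real ` {0::real<..} :: complex set)"
        by (subst finite_image_iff) (auto simp: inj_on_def infinite_Ioi)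
      ultimately have "p - q = 0"
        using poly_roots_finite finite_subset by blast
      then show "f zs = g zs"
        using pq[of "zs ! k"] by simp
    qed
  qed
  from this[of n] show ?thesis
    using assms(4) by simp
qed

section \<open>Moments of the Fermi function\<close>

definition fermi :: "real \<Rightarrow> real" where
  "fermi u = 1 / (1 + exp (u / 2))"

lemma mirzakhani_H_eq: "mirzakhani_H x y = fermi (x + y) + fermi (x - y)"
  by (simp add: mirzakhani_H_def fermi_def)

lemma one_plus_exp_nonzero: "1 + exp x \<noteq> (0 :: real)"
  using exp_gt_zero[of x] by linarith

lemma fermi_pos: "fermi u > 0"
  by (simp add: fermi_def add_pos_pos)

lemma fermi_minus: "fermi (- u) = 1 - fermi u"
  using one_plus_exp_nonzero[of "u / 2"] by (simp add: fermi_def exp_minus field_simps)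

lemma continuous_on_fermi [continuous_intros]:
  "continuous_on S f \<Longrightarrow> continuous_on S (\<lambda>x. fermi (f x))"
  unfolding fermi_def by (intro continuous_intros ballI one_plus_exp_nonzero) simp_all

lemma measurable_fermi [measurable]: "fermi \<in> borel_measurable borel"
  by (intro borel_measurable_continuous_onI continuous_intros)

text \<open>In the bound \<open>fermi u \<le> exp (- u / 2)\<close> one factor
  \<open>exp (- u / 4)\<close> absorbs the power of \<open>u\<close> beyond some \<open>N\<close>,
  and the other dominates the tail.\<close>

lemma set_integrable_power_fermi: "set_integrable lborel {0..} (\<lambda>u. u ^ k * fermi u)"
proof -
  have "((\<lambda>u::real. u ^ k * exp (- u / 4)) \<longlongrightarrow> 0) at_top"
    by real_asymp
  then have "\<forall>\<^sub>F u::real in at_top. u ^ k * exp (- u / 4) < 1"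
    by (rule order_tendstoD) simp
  then obtain N0 where N0: "\<And>u::real. u \<ge> N0 \<Longrightarrow> u ^ k * exp (- u / 4) < 1"
    by (auto simp: eventually_at_top_linorder)
  define N where "N = max N0 0"
  have 1: "set_integrable lborel {0..N} (\<lambda>u. u ^ k * fermi u)"
    by (intro borel_integrable_atLeastAtMost' continuous_intros)
  have 2: "set_integrable lborel {N..} (\<lambda>u. u ^ k * fermi u)"
    unfolding set_integrable_def
  proof (rule Bochner_Integration.integrable_bound)
    show "integrable lborel (\<lambda>u. exp (- u / 4) * indicator {N..} u)"
    proof (rule integrableI_nn_integral_finite)
      have "(\<integral>\<^sup>+u. ennreal (exp (- u / 4)) * indicator {N..} u \<partial>lborel) = 0 - (- 4 * exp (- N / 4))"
      proof (rule nn_integral_FTC_atLeast)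
        show "((\<lambda>u::real. - 4 * exp (- u / 4)) \<longlongrightarrow> 0) at_top"
          by real_asymp
      qed (auto intro!: derivative_eq_intros)
      then show "(\<integral>\<^sup>+u. ennreal (exp (- u / 4) * indicator {N..} u) \<partial>lborel) = ennreal (4 * exp (- N / 4))"
        by (simp add: ennreal_mult ennreal_indicator)
    qed auto
    show "AE u in lborel. norm (indicator {N..} u *\<^sub>R (u ^ k * fermi u)) \<le> norm (exp (- u / 4) * indicator {N..} u)"
    proof (intro AE_I2)
      fix u :: real
      have "u ^ k * fermi u \<le> exp (- u / 4)" if "u \<ge> N"
      proof -
        have u: "u \<ge> 0" "u ^ k * exp (- u / 4) < 1"
          using that N0 by (auto simp: N_def)
        have "fermi u \<le> exp (- u / 2)"
          by (simp add: fermi_def exp_minus field_simps add_pos_pos)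
        also have "\<dots> = exp (- u / 4) * exp (- u / 4)"
          by (simp flip: exp_add)
        finally have "u ^ k * fermi u \<le> (u ^ k * exp (- u / 4)) * exp (- u / 4)"
          using u by (simp add: mult.assoc mult_left_mono)
        also have "\<dots> \<le> 1 * exp (- u / 4)"
          using u by (intro mult_right_mono) auto
        finally show ?thesis
          by simp
      qed
      moreover have "u ^ k * fermi u \<ge> 0" if "u \<ge> N"
        using that fermi_pos[of u] by (auto simp: N_def)
      ultimately show "norm (indicator {N..} u *\<^sub>R (u ^ k * fermi u)) \<le> norm (exp (- u / 4) * indicator {N..} u)"
        by (simp add: indicator_def)
    qed
  qed simp
  show ?thesis
    using set_integrable_Un[OF 1 2] by (rule set_integrable_subset) (auto simp: N_def)
qed

section \<open>Appell polynomials of the Fermi function and the moments of H\<close>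

definition fermi_moment :: "nat \<Rightarrow> real" where
  "fermi_moment k = (LINT u:{0..}|lborel. u ^ k * fermi u)"

text \<open>The integral of \<open>(z + u) ^ M * fermi u\<close> over u \<ge> 0, expanded by the
  binomial theorem. Its derivative is \<open>M\<close> times the preceding member, which makes this
  an Appell sequence.\<close>

definition appell :: "nat \<Rightarrow> complex \<Rightarrow> complex" where
  "appell M z = (\<Sum>k\<le>M. of_nat (M choose k) * of_real (fermi_moment (M - k)) * z ^ k)"

lemma set_integrable_complex_of_real:
  "set_integrable M A f \<Longrightarrow> set_integrable M A (\<lambda>x. complex_of_real (f x))"
  by (simp add: set_integrable_def scaleR_conv_of_real complex_of_real_integrable_eq flip: of_real_mult)

lemma set_integral_sum:
  fixes f :: "'i \<Rightarrow> 'a \<Rightarrow> 'b :: {banach, second_countable_topology}"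
  assumes "\<And>k. k \<in> K \<Longrightarrow> set_integrable M A (f k)"
  shows "set_integrable M A (\<lambda>x. \<Sum>k\<in>K. f k x)"
    and "(LINT x:A|M. \<Sum>k\<in>K. f k x) = (\<Sum>k\<in>K. LINT x:A|M. f k x)"
  using assms unfolding set_integrable_def set_lebesgue_integral_def scaleR_sum_right
  by (auto intro!: Bochner_Integration.integral_sum)

lemma has_integral_appell:
  "set_integrable lborel {0..} (\<lambda>u. (z + of_real u) ^ M * of_real (fermi u) :: complex)"
  "(LINT u:{0..}|lborel. (z + of_real u) ^ M * of_real (fermi u)) = appell M z"
proof -
  have *: "(z + of_real u) ^ M * of_real (fermi u)
    = (\<Sum>k\<le>M. of_nat (M choose k) * z ^ k * of_real (u ^ (M - k) * fermi u))" for u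
    unfolding binomial_ring sum_distrib_right by (intro sum.cong refl) (simp add: mult_ac)
  have int: "set_integrable lborel {0..} (\<lambda>u. of_nat (M choose k) * z ^ k * of_real (u ^ (M - k) * fermi u))" for k
    by (intro set_integrable_mult_right impI set_integrable_complex_of_real set_integrable_power_fermi)
  show "set_integrable lborel {0..} (\<lambda>u. (z + of_real u) ^ M * of_real (fermi u) :: complex)"
    unfolding * by (intro set_integral_sum(1) int)
  show "(LINT u:{0..}|lborel. (z + of_real u) ^ M * of_real (fermi u)) = appell M z"
    unfolding * appell_def
    by (subst set_integral_sum(2)[OF int]) (auto simp: set_integral_mult_right
        set_integral_complex_of_real fermi_moment_def mult_ac intro!: sum.cong
        simp del: of_real_mult of_real_power)
qed

lemma appell_deriv: "(appell (Suc m) has_field_derivative of_nat (Suc m) * appell m z) (at z)"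
proof -
  have "(appell (Suc m) has_field_derivative
      (\<Sum>k\<le>Suc m. of_nat (Suc m choose k) * of_real (fermi_moment (Suc m - k)) * (of_nat k * z ^ (k - 1)))) (at z)"
    unfolding appell_def by (rule DERIV_sum) (auto intro!: derivative_eq_intros)
  also have "(\<Sum>k\<le>Suc m. of_nat (Suc m choose k) * of_real (fermi_moment (Suc m - k)) * (of_nat k * z ^ (k - 1)))
    = (\<Sum>k\<le>m. of_nat (Suc k * (Suc m choose Suc k)) * (of_real (fermi_moment (m - k)) * z ^ k))"
    by (subst sum.atMost_Suc_shift) (simp add: algebra_simps del: binomial_Suc_Suc)
  also have "\<dots> = of_nat (Suc m) * appell m z"
    unfolding Suc_times_binomial appell_def sum_distrib_left
    by (intro sum.cong refl) (simp add: algebra_simps)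
  finally show ?thesis .
qed

lemma set_integrable_shifted_power_fermi:
  "set_integrable lborel {a..} (\<lambda>u. (u + s) ^ k * fermi u)"
proof -
  have "set_integrable lborel {0..} (\<lambda>u. (u + s) ^ k * fermi u)"
    using has_integral_appell(1)[of "of_real s" k]
    by (simp add: set_integrable_def complex_of_real_integrable_eq add.commute scaleR_conv_of_real flip: of_real_add of_real_power of_real_mult)
  moreover have "set_integrable lborel {min a 0..0} (\<lambda>u. (u + s) ^ k * fermi u)"
    by (intro borel_integrable_atLeastAtMost' continuous_intros)
  ultimately have "set_integrable lborel ({0..} \<union> {min a 0..0}) (\<lambda>u. (u + s) ^ k * fermi u)"
    by (intro set_integrable_Un) auto
  then show ?thesis
    by (rule set_integrable_subset) auto
qed

lemma set_integral_shift:
  fixes f :: "real \<Rightarrow> 'a :: euclidean_space"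
  shows "(LINT x:{0..}|lborel. f x) = (LINT u:{s..}|lborel. f (u - s))"
    and "set_integrable lborel {0..} f \<longleftrightarrow> set_integrable lborel {s..} (\<lambda>u. f (u - s))"
proof -
  have *: "indicator {s..} (s + 1 * x) *\<^sub>R f (s + 1 * x - s) = indicator {0..} x *\<^sub>R f x" for x
    by (auto simp: indicator_def)
  show "(LINT x:{0..}|lborel. f x) = (LINT u:{s..}|lborel. f (u - s))"
    unfolding set_lebesgue_integral_def
    by (subst (2) lborel_integral_real_affine[where c = 1 and t = s]) (simp_all only: *, simp_all)
  show "set_integrable lborel {0..} f \<longleftrightarrow> set_integrable lborel {s..} (\<lambda>u. f (u - s))"
    unfolding set_integrable_def
    using lborel_integrable_real_affine_iff[of 1 "\<lambda>u. indicator {s..} u *\<^sub>R f (u - s)" s] unfolding * by simp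
qed

lemma set_integrable_power_mirzakhani_H:
  "set_integrable lborel {0..} (\<lambda>x. x ^ k * fermi (x + t))"
  "set_integrable lborel {0..} (\<lambda>x. x ^ k * mirzakhani_H x t)"
proof -
  have *: "set_integrable lborel {0..} (\<lambda>x. x ^ k * fermi (x + t))" for t
    using set_integrable_shifted_power_fermi[of t "- t" k] by (subst set_integral_shift(2)[of _ t]) simp
  show "set_integrable lborel {0..} (\<lambda>x. x ^ k * fermi (x + t))"
    by (rule *)
  show "set_integrable lborel {0..} (\<lambda>x. x ^ k * mirzakhani_H x t)"
    using set_integral_add(1)[OF *[of t] *[of "- t"]] by (simp add: mirzakhani_H_eq distrib_left)
qed

text \<open>Substituting u = x + t and u = x - t moves the two halves of H to the half lines from t
  and from -t. Each differs from the half line from 0 by an interval of length t. After reflecting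
  the interval below 0, with f(-u) = 1 - f(u), and using that \<open>m\<close> is odd, the two
  corrections carry the weights f and 1 - f, and their sum is the elementary integral of
  \<open>(t - u) ^ m\<close>.\<close>

lemma LINT_power_mirzakhani_H_nonneg:
  assumes "odd m" "t \<ge> 0"
  shows "(LINT x:{0..}|lborel. x ^ m * mirzakhani_H x t)
    = t ^ Suc m / real (Suc m) + (LINT u:{0..}|lborel. (u + t) ^ m * fermi u) + (LINT u:{0..}|lborel. (u - t) ^ m * fermi u)"
proof -
  have int: "set_integrable lborel {a..} (\<lambda>u. (u + s) ^ m * fermi u)"
       "set_integrable lborel {a..} (\<lambda>u. (u - s) ^ m * fermi u)" for a s
    using set_integrable_shifted_power_fermi[of a s m] set_integrable_shifted_power_fermi[of a "-s" m]
    by auto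
  have cint: "set_integrable lborel {a..b} (\<lambda>u. (u + s) ^ m * fermi u)"
       "set_integrable lborel {a..b} (\<lambda>u. (u - s) ^ m * fermi u)"
       "set_integrable lborel {a..b} (\<lambda>u. (s - u) ^ m * (1 - fermi u))"
       "set_integrable lborel {a..b} (\<lambda>u. (s - u) ^ m * fermi u)" for a b s
    by (intro borel_integrable_atLeastAtMost' continuous_intros)+
  \<comment> \<open>The closed pieces glued below share one endpoint, so they are disjoint only
    almost everywhere.\<close>
  have AE: "AE x in lborel. \<not> (x \<in> {a..c} \<and> x \<in> {c..})" for a c :: real
    using AE_lborel_singleton[of c] by eventually_elim auto
  have 1: "(LINT x:{0..}|lborel. x ^ m * fermi (x + t)) = (LINT u:{t..}|lborel. (u - t) ^ m * fermi u)"
    by (subst set_integral_shift(1)[of _ t]) simp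
  have "(LINT u:{0..t} \<union> {t..}|lborel. (u - t) ^ m * fermi u)
     = (LINT u:{0..t}|lborel. (u - t) ^ m * fermi u) + (LINT u:{t..}|lborel. (u - t) ^ m * fermi u)"
    by (intro set_integral_Un_AE AE int cint) auto
  moreover have "{0..t} \<union> {t..} = {0..}"
    using assms by auto
  moreover have "(LINT u:{0..t}|lborel. (u - t) ^ m * fermi u) = - (LINT u:{0..t}|lborel. (t - u) ^ m * fermi u)"
  proof -
    have "(u - t) ^ m = - ((t - u) ^ m)" for u
      using power_minus_odd[OF assms(1), of "t - u"] by simp
    then show ?thesis
      by (simp add: set_lebesgue_integral_def)
  qed
  ultimately have 2: "(LINT u:{t..}|lborel. (u - t) ^ m * fermi u)
     = (LINT u:{0..}|lborel. (u - t) ^ m * fermi u) + (LINT u:{0..t}|lborel. (t - u) ^ m * fermi u)"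
    by simp
  have 3: "(LINT x:{0..}|lborel. x ^ m * fermi (x - t)) = (LINT u:{-t..}|lborel. (u + t) ^ m * fermi u)"
    by (subst set_integral_shift(1)[of _ "- t"]) simp
  have "(LINT u:{-t..0} \<union> {0..}|lborel. (u + t) ^ m * fermi u)
     = (LINT u:{-t..0}|lborel. (u + t) ^ m * fermi u) + (LINT u:{0..}|lborel. (u + t) ^ m * fermi u)"
    by (intro set_integral_Un_AE AE int cint) auto
  moreover have "{-t..0} \<union> {0..} = {-t..}"
    using assms by auto
  moreover have "(LINT u:{-t..0}|lborel. (u + t) ^ m * fermi u) = (LINT u:{0..t}|lborel. (t - u) ^ m * (1 - fermi u))"
    unfolding set_lebesgue_integral_def
    by (subst lborel_integral_real_affine[where c = "-1" and t = 0])
      (auto simp: fermi_minus indicator_def intro!: Bochner_Integration.integral_cong)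
  ultimately have 4: "(LINT u:{-t..}|lborel. (u + t) ^ m * fermi u)
     = (LINT u:{0..t}|lborel. (t - u) ^ m * (1 - fermi u)) + (LINT u:{0..}|lborel. (u + t) ^ m * fermi u)"
    by simp
  have "(LINT u:{0..t}|lborel. (t - u) ^ m * fermi u) + (LINT u:{0..t}|lborel. (t - u) ^ m * (1 - fermi u))
     = (LINT u:{0..t}|lborel. (t - u) ^ m)"
    by (subst set_integral_add(2)[symmetric, OF cint(4,3)]) (simp add: algebra_simps)
  also have "\<dots> = - ((t - t) ^ Suc m / real (Suc m)) - - ((t - 0) ^ Suc m / real (Suc m))"
    unfolding set_lebesgue_integral_def
    by (rule integral_FTC_atLeastAtMost) (use assms in \<open>auto intro!: derivative_eq_intros continuous_intros
       simp flip: has_real_derivative_iff_has_vector_derivative simp del: power_Suc\<close>)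
  finally have 5: "(LINT u:{0..t}|lborel. (t - u) ^ m * fermi u) + (LINT u:{0..t}|lborel. (t - u) ^ m * (1 - fermi u))
     = t ^ Suc m / real (Suc m)"
    by simp
  have "(LINT x:{0..}|lborel. x ^ m * mirzakhani_H x t)
      = (LINT x:{0..}|lborel. x ^ m * fermi (x + t)) + (LINT x:{0..}|lborel. x ^ m * fermi (x - t))"
    using set_integral_add(2)[OF set_integrable_power_mirzakhani_H(1)[of m t] set_integrable_power_mirzakhani_H(1)[of m "-t"]]
    by (simp add: mirzakhani_H_eq distrib_left)
  then show ?thesis
    unfolding 1 2 3 4 using 5 by simp
qed

text \<open>Both sides are even in \<open>t\<close>, which extends the formula to the negative
  arguments b - b_j.\<close>

lemma LINT_power_mirzakhani_H:
  assumes "odd m"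
  shows "complex_of_real (LINT x:{0..}|lborel. x ^ m * mirzakhani_H x t)
    = of_real t ^ Suc m / of_nat (Suc m) + appell m (of_real t) + appell m (- of_real t)"
proof -
  have A: "appell m (of_real s) = of_real (LINT u:{0..}|lborel. (u + s) ^ m * fermi u)" for s
    by (subst has_integral_appell(2)[symmetric])
      (simp add: add.commute flip: of_real_add of_real_mult of_real_power set_integral_complex_of_real)
  have *: "complex_of_real (LINT x:{0..}|lborel. x ^ m * mirzakhani_H x t)
    = of_real t ^ Suc m / of_nat (Suc m) + appell m (of_real t) + appell m (- of_real t)" if "t \<ge> 0" for t
    unfolding LINT_power_mirzakhani_H_nonneg[OF assms that] A A[of "- t", simplified] by simp
  show ?thesis
  proof (cases "t \<ge> 0")
    case False
    then show ?thesis
      using *[of "- t"] assms by (simp add: mirzakhani_H_eq add.commute)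
  qed (rule *)
qed

section \<open>The difference equation for the primitive\<close>

text \<open>The zeros of 1 - e^(z/2) are the multiples of 4 pi i, so the origin is the only one in
  the strip.\<close>

lemma exp_half_eq_1_strip:
  assumes "\<bar>Im z\<bar> \<le> 2 * pi" "exp (z / 2) = 1"
  shows "z = 0"
proof -
  obtain n :: int where n: "Re (z / 2) = 0" "Im (z / 2) = of_int (2 * n) * pi"
    using assms(2) unfolding exp_eq_1 by auto
  then have "\<bar>of_int n\<bar> * (4 * pi) \<le> 2 * pi"
    using assms(1) by (simp add: abs_mult)
  then have "\<bar>real_of_int n\<bar> < 1"
    by (smt (verit) pi_gt_zero mult_le_cancel_right1 mult_less_cancel_right)
  then have "n = 0"
    by linarith
  with n show ?thesis
    by (simp add: complex_eq_iff)
qed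

lemma convex_vertical_line: "convex {z. Re z = R}"
  by (auto simp: convex_alt algebra_simps)

text \<open>The counterpart of \<open>fermi_minus\<close> for 1 / (1 - e^(z/2)), used on the
  imaginary axis.\<close>

lemma reciprocal_exp_half_sum: "1 / (1 - exp (z / 2)) + 1 / (1 - exp (- z / 2)) = (1 :: complex)"
  if "exp (z / 2) \<noteq> 1"
  using that by (simp add: exp_minus divide_simps) (simp add: algebra_simps)

text \<open>The integrand on the left is \<open>g (u + 2 \<pi> i) - g (u - 2 \<pi> i)\<close> for
  \<open>g z = (k z - k 0) / (1 - exp (z / 2))\<close> and \<open>k z = (t + z)\<^sup>M + (t - z)\<^sup>M\<close>, and \<open>g\<close> has a
  primitive on the half strip \<open>Re z \<ge> 0, \<bar>Im z\<bar> \<le> 2 \<pi>\<close> because \<open>k\<close> is even. On the imaginary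
  axis, \<open>g z + g (- z) = k z - k 0\<close>.\<close>

lemma half_strip_integral:
  fixes t :: complex and M :: nat
  defines "k \<equiv> \<lambda>z. (t + z) ^ M + (t - z) ^ M"
  assumes int: "set_integrable lborel {0..} (\<lambda>u. (k (of_real u + 2 * pi * \<i>) - k (of_real u - 2 * pi * \<i>)) * of_real (fermi u))"
  shows "(LINT u:{0..}|lborel. (k (of_real u + 2 * pi * \<i>) - k (of_real u - 2 * pi * \<i>)) * of_real (fermi u))
    = 4 * pi * \<i> * t ^ M - ((t + 2 * pi * \<i>) ^ Suc M - (t - 2 * pi * \<i>) ^ Suc M) / of_nat (Suc M)"
proof -
  \<comment> \<open>Subtracting \<open>k 0\<close> cancels the pole at the origin. On the horizontal
    sides the two denominators coincide, so the constant disappears from the difference.\<close>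
  define g where "g = (\<lambda>z. (k z - k 0) / (1 - exp (z / 2)))"
  define S where "S = {z. 0 \<le> Re z} \<inter> {z. Im z \<le> 2 * pi} \<inter> {z. Im z \<ge> - 2 * pi}"
  define h where "h = complex_of_real (2 * pi) * \<i>"
  have S_iff: "z \<in> S \<longleftrightarrow> 0 \<le> Re z \<and> \<bar>Im z\<bar> \<le> 2 * pi" for z
    by (auto simp: S_def)
  have g_diff: "g field_differentiable at z" if "z \<noteq> 0" "z \<in> S" for z
  proof -
    have "exp (z / 2) \<noteq> 1"
      using exp_half_eq_1_strip[of z] that by (auto simp: S_iff)
    then show ?thesis
      unfolding g_def k_def field_differentiable_def
      by (intro exI) (rule derivative_eq_intros refl | simp)+
  qed
  \<comment> \<open>At 0 the quotient is 0 / 0, which is 0 by convention. This is the true limit: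
    the numerator has derivative 0 there because \<open>k\<close> is even, the denominator has
    derivative -1/2.\<close>
  have g_0: "isCont g 0"
  proof -
    have "(k has_field_derivative 0) (at 0)"
      unfolding k_def by (auto intro!: derivative_eq_intros)
    then have 1: "((\<lambda>z. (k z - k 0) / z) \<longlongrightarrow> 0) (at 0)"
      by (simp add: has_field_derivative_iff)
    have "((\<lambda>z::complex. 1 - exp (z / 2)) has_field_derivative - 1 / 2) (at 0)"
      by (auto intro!: derivative_eq_intros)
    then have 2: "((\<lambda>z::complex. (1 - exp (z / 2)) / z) \<longlongrightarrow> - 1 / 2) (at 0)"
      by (simp add: has_field_derivative_iff)
    have "((\<lambda>z. ((k z - k 0) / z) / ((1 - exp (z / 2)) / z)) \<longlongrightarrow> 0) (at 0)"
      using tendsto_divide[OF 1 2] by simp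
    then have "(g \<longlongrightarrow> 0) (at 0)"
      by (rule Lim_transform_eventually) (auto simp: eventually_at_filter g_def)
    then show ?thesis
      by (simp add: isCont_def g_def)
  qed
  have g_cont: "continuous_on S g"
  proof (intro continuous_at_imp_continuous_on ballI)
    show "isCont g z" if "z \<in> S" for z
      using g_0 g_diff[of z] that by (cases "z = 0") (auto dest: field_differentiable_imp_continuous_at)
  qed
  have "convex S"
    unfolding S_def by (intro convex_Int convex_halfspace_Re_ge convex_halfspace_Im_ge convex_halfspace_Im_le)
  moreover have "g field_differentiable at z" if "z \<in> interior S - {0}" for z
    using g_diff[of z] interior_subset[of S] that by auto
  \<comment> \<open>With a primitive on the closed half strip, Cauchy's theorem becomes bookkeeping
    of values of \<open>G\<close> at the corners.\<close>
  ultimately obtain G where G: "\<And>z. z \<in> S \<Longrightarrow> (G has_field_derivative g z) (at z within S)"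
    using g_cont holomorphic_convex_primitive[of S "{0}" g] by (metis finite.emptyI finite.insertI)
  have line: "((\<lambda>u. G (c + of_real u * d)) has_vector_derivative d * g (c + of_real u * d)) (at u within {a..b})"
    "continuous_on {a..b} (\<lambda>u. d * g (c + of_real u * d))"
    if "\<And>v. a \<le> v \<Longrightarrow> v \<le> b \<Longrightarrow> c + of_real v * d \<in> S" "a \<le> u" "u \<le> b" for a b c d u
  proof -
    have sub: "(\<lambda>u. c + of_real u * d) ` {a..b} \<subseteq> S"
      using that(1) by auto
    have "((G \<circ> (\<lambda>u. c + of_real u * d)) has_vector_derivative d * g (c + of_real u * d)) (at u within {a..b})"
      by (rule field_vector_diff_chain_within)
        (use that sub in \<open>auto intro!: derivative_eq_intros DERIV_subset[OF G]\<close>)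
    then show "((\<lambda>u. G (c + of_real u * d)) has_vector_derivative d * g (c + of_real u * d)) (at u within {a..b})"
      by (simp add: o_def)
    show "continuous_on {a..b} (\<lambda>u. d * g (c + of_real u * d))"
      using sub by (intro continuous_intros continuous_on_compose2[OF g_cont])
  qed
  have FTC: "(LINT u:{a..b}|lborel. d * g (c + of_real u * d)) = G (c + of_real b * d) - G (c + of_real a * d)"
    and FTC_int: "set_integrable lborel {a..b} (\<lambda>u. d * g (c + of_real u * d))"
    if "a \<le> b" "\<And>v. a \<le> v \<Longrightarrow> v \<le> b \<Longrightarrow> c + of_real v * d \<in> S" for a b c d
  proof -
    show "(LINT u:{a..b}|lborel. d * g (c + of_real u * d)) = G (c + of_real b * d) - G (c + of_real a * d)"
      unfolding set_lebesgue_integral_def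
      by (rule integral_FTC_atLeastAtMost) (use that in \<open>auto intro: line(1) line(2)[of a b c d a]\<close>)
    show "set_integrable lborel {a..b} (\<lambda>u. d * g (c + of_real u * d))"
      by (rule borel_integrable_atLeastAtMost', rule line(2)[of a b c d a]) (use that in auto)
  qed
  \<comment> \<open>The left side is traversed upwards and downwards. Subtracting the two integrals
    pairs \<open>g z\<close> with \<open>g (- z)\<close>, whose sum is the polynomial
    \<open>k z - k 0\<close>; this accounts for the factor 2.\<close>
  have left: "2 * (G h - G (- h)) = 2 * (((t + h) ^ Suc M - (t - h) ^ Suc M) / of_nat (Suc M) - 2 * h * t ^ M)"
  proof -
    have ax: "0 + of_real v * \<i> \<in> S" "0 + of_real v * - \<i> \<in> S" if "- (2 * pi) \<le> v" "v \<le> 2 * pi" for v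
      using that by (auto simp: S_iff)
    have 1: "(LINT v:{- (2 * pi)..2 * pi}|lborel. \<i> * g (0 + of_real v * \<i>)) = G h - G (- h)"
      by (subst FTC) (use ax in \<open>auto simp: h_def\<close>)
    have 2: "(LINT v:{- (2 * pi)..2 * pi}|lborel. - \<i> * g (0 + of_real v * - \<i>)) = G (- h) - G h"
      by (subst FTC) (use ax in \<open>auto simp: h_def\<close>)
    have "2 * (G h - G (- h)) = (LINT v:{- (2 * pi)..2 * pi}|lborel.
       \<i> * g (0 + of_real v * \<i>) - (- \<i> * g (0 + of_real v * - \<i>)))"
      by (subst set_integral_diff(2)[OF FTC_int FTC_int]) (use ax 1 2 in \<open>auto\<close>)
    also have "\<dots> = (LINT v:{- (2 * pi)..2 * pi}|lborel. \<i> * (k (of_real v * \<i>) - k 0))"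
    proof (rule set_lebesgue_integral_cong)
      show "\<forall>v. v \<in> {- (2 * pi)..2 * pi} \<longrightarrow>
          \<i> * g (0 + of_real v * \<i>) - (- \<i> * g (0 + of_real v * - \<i>)) = \<i> * (k (of_real v * \<i>) - k 0)"
      proof (intro allI impI)
        fix v assume v: "v \<in> {- (2 * pi)..2 * pi}"
        define z where "z = of_real v * \<i>"
        have "g z + g (- z) = k z - k 0"
        proof (cases "z = 0")
          case False
          have "exp (z / 2) \<noteq> 1"
            using exp_half_eq_1_strip[of z] v False by (auto simp: z_def abs_le_iff)
          have "g z + g (- z) = (k z - k 0) * (1 / (1 - exp (z / 2)) + 1 / (1 - exp (- z / 2)))"
            by (simp add: g_def k_def add.commute distrib_left)
          then show ?thesis
            using reciprocal_exp_half_sum[OF \<open>exp (z / 2) \<noteq> 1\<close>] by simp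
        qed (simp add: g_def)
        then show "\<i> * g (0 + of_real v * \<i>) - (- \<i> * g (0 + of_real v * - \<i>)) = \<i> * (k (of_real v * \<i>) - k 0)"
          by (simp add: z_def flip: distrib_left)
      qed
    qed simp
    also have "\<dots> = (((t + h) ^ Suc M - (t - h) ^ Suc M) / of_nat (Suc M) - h * k 0)
      - (((t + - h) ^ Suc M - (t - - h) ^ Suc M) / of_nat (Suc M) - - h * k 0)"
    proof -
      \<comment> \<open>An explicit odd primitive of \<open>k z - k 0\<close>; since
        \<open>k 0 = 2 * t ^ M\<close>, its linear part produces the term with
        \<open>t ^ M\<close>.\<close>
      define F where "F = (\<lambda>z. ((t + z) ^ Suc M - (t - z) ^ Suc M) / of_nat (Suc M) - z * k 0)"
      have F: "(F has_field_derivative k z - k 0) (at z)" for z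
      proof -
        have "((\<lambda>z. (t + z) ^ Suc M) has_field_derivative of_nat (Suc M) * (t + z) ^ M) (at z)"
          "((\<lambda>z. (t - z) ^ Suc M) has_field_derivative - of_nat (Suc M) * (t - z) ^ M) (at z)"
          by (auto intro!: derivative_eq_intros simp del: power_Suc of_nat_Suc)
        then have "(F has_field_derivative
            (of_nat (Suc M) * (t + z) ^ M - - of_nat (Suc M) * (t - z) ^ M) / of_nat (Suc M) - 1 * k 0) (at z)"
          unfolding F_def by (intro DERIV_diff DERIV_cdivide DERIV_cmult_right DERIV_ident)
        moreover have "(of_nat (Suc M) * (t + z) ^ M - - of_nat (Suc M) * (t - z) ^ M) / of_nat (Suc M) - 1 * k 0 = k z - k 0"
          by (simp add: k_def divide_simps del: of_nat_Suc) (simp add: algebra_simps)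
        ultimately show ?thesis
          by metis
      qed
      have "((\<lambda>v. F (of_real v * \<i>)) has_vector_derivative \<i> * (k (of_real v * \<i>) - k 0)) (at v within A)" for v A
      proof -
        have "((F \<circ> (\<lambda>v. of_real v * \<i>)) has_vector_derivative \<i> * (k (of_real v * \<i>) - k 0)) (at v within A)"
          by (rule field_vector_diff_chain_within)
            (auto intro!: derivative_eq_intros DERIV_subset[OF F])
        then show ?thesis
          by (simp add: o_def)
      qed
      then have "(LINT v:{- (2 * pi)..2 * pi}|lborel. \<i> * (k (of_real v * \<i>) - k 0))
         = F (of_real (2 * pi) * \<i>) - F (of_real (- (2 * pi)) * \<i>)"
        unfolding set_lebesgue_integral_def
        by (intro integral_FTC_atLeastAtMost) (auto simp: k_def intro!: continuous_intros)
      then show ?thesis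
        by (simp add: F_def h_def)
    qed
    also have "\<dots> = 2 * (((t + h) ^ Suc M - (t - h) ^ Suc M) / of_nat (Suc M) - 2 * h * t ^ M)"
      by (simp add: k_def field_simps del: of_nat_Suc power_Suc)
    finally show ?thesis .
  qed
  have g_shift: "g (of_real u + h) = (k (of_real u + h) - k 0) * of_real (fermi u)"
      "g (of_real u - h) = (k (of_real u - h) - k 0) * of_real (fermi u)" for u
  proof -
    have "exp (h / 2) = -1" "exp (- (h / 2)) = -1"
      by (simp_all add: h_def exp_minus)
    then have "exp ((of_real u + h) / 2) = - of_real (exp (u / 2))"
      "exp ((of_real u - h) / 2) = - of_real (exp (u / 2))"
      by (simp_all add: add_divide_distrib diff_divide_distrib exp_add exp_diff exp_minus exp_of_real[symmetric]
          inverse_eq_iff_eq del: exp_of_real)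
    then show "g (of_real u + h) = (k (of_real u + h) - k 0) * of_real (fermi u)"
      "g (of_real u - h) = (k (of_real u - h) - k 0) * of_real (fermi u)"
      by (simp_all add: g_def fermi_def)
  qed
  define f where "f = (\<lambda>u. (k (of_real u + h) - k (of_real u - h)) * complex_of_real (fermi u))"
  have f_g: "f u = g (of_real u + h) - g (of_real u - h)" for u
    unfolding f_def g_shift by (simp add: algebra_simps)
  have seg: "(LINT u:{0..R}|lborel. f u) = (G (of_real R + h) - G (of_real R - h)) - (G h - G (- h))" if "R \<ge> 0" for R
  proof -
    have *: "h + of_real v * 1 \<in> S" "- h + of_real v * 1 \<in> S" if "0 \<le> v" for v
      using that by (auto simp: S_iff h_def)
    have "(LINT u:{0..R}|lborel. f u) = (LINT u:{0..R}|lborel. 1 * g (h + of_real u * 1) - 1 * g (- h + of_real u * 1))"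
      by (simp add: f_g add.commute)
    also have "\<dots> = (G (h + of_real R * 1) - G (h + of_real 0 * 1)) - (G (- h + of_real R * 1) - G (- h + of_real 0 * 1))"
      by (subst set_integral_diff(2)[OF FTC_int FTC_int]; (subst FTC)?; (subst FTC)?) (use * that in auto)
    finally show ?thesis
      by (simp add: algebra_simps)
  qed
  have lim1: "((\<lambda>R. LINT u:{0..R}|lborel. f u) \<longlongrightarrow> (LINT u:{0..}|lborel. f u)) at_top"
  proof -
    have "((\<lambda>R. LINT u|lborel. indicator {..R} u *\<^sub>R (indicator {0..} u *\<^sub>R f u)) \<longlongrightarrow> (LINT u:{0..}|lborel. f u)) at_top"
      using int unfolding set_lebesgue_integral_def set_integrable_def f_def h_def
      by (intro tendsto_integral_at_top) simp_all
    moreover have "indicator {..R} u *\<^sub>R (indicator {0..} u *\<^sub>R f u) = indicator {0..R} u *\<^sub>R f u" for R u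
      by (auto simp: indicator_def)
    ultimately show ?thesis
      unfolding set_lebesgue_integral_def by (simp only:)
  qed
  \<comment> \<open>The right side is a segment of length 4 pi on which \<open>g\<close> is at most
    a polynomial in R over e^(R/2) - 1, so its contribution vanishes.\<close>
  have lim2: "((\<lambda>R. G (of_real R + h) - G (of_real R - h)) \<longlongrightarrow> 0) at_top"
  proof (rule Lim_null_comparison)
    \<comment> \<open>On that side |z| \<le> R + 2 pi, hence both |t + z| and |t - z| are at most
      \<open>C + R\<close>.\<close>
    define C where "C = norm t + 2 * pi"
    define B where "B = (\<lambda>R. (2 * (C + R) ^ M + norm (k 0)) / (exp (R / 2) - 1))"
    show "\<forall>\<^sub>F R in at_top. norm (G (of_real R + h) - G (of_real R - h)) \<le> 4 * pi * B R"
      using eventually_gt_at_top[of 0]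
    proof eventually_elim
      case (elim R)
      have bound: "norm (g z) \<le> B R" if "z \<in> S \<inter> {z. Re z = R}" for z
      proof -
        have "norm z \<le> R + 2 * pi"
          using cmod_le[of z] that elim by (auto simp: S_iff)
        then have "norm (t + z) \<le> C + R" "norm (t - z) \<le> C + R"
          using norm_triangle_ineq[of t z] norm_triangle_ineq4[of t z] by (auto simp: C_def)
        then have "norm ((t + z) ^ M) \<le> (C + R) ^ M" "norm ((t - z) ^ M) \<le> (C + R) ^ M"
          by (simp_all add: norm_power power_mono)
        then have "norm (k z - k 0) \<le> 2 * (C + R) ^ M + norm (k 0)"
          using norm_triangle_ineq[of "(t + z) ^ M" "(t - z) ^ M"] norm_triangle_ineq4[of "k z" "k 0"]
          by (simp add: k_def)
        moreover have "norm (1 - exp (z / 2)) \<ge> exp (R / 2) - 1"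
          using norm_triangle_ineq2[of "exp (z / 2)" 1] using that by (simp add: norm_minus_commute)
        moreover have "exp (R / 2) - 1 > 0"
          using elim by simp
        ultimately show ?thesis
          unfolding g_def norm_divide B_def by (intro frac_le order_trans[OF norm_ge_zero])
      qed
      have "norm (G (of_real R + h) - G (of_real R - h)) \<le> B R * norm ((of_real R + h) - (of_real R - h))"
      proof (rule field_differentiable_bound[where S = "S \<inter> {z. Re z = R}"])
        show "convex (S \<inter> {z. Re z = R})"
          by (intro convex_Int \<open>convex S\<close> convex_vertical_line)
        show "norm (g z) \<le> B R" if "z \<in> S \<inter> {z. Re z = R}" for z
          using that by (rule bound)
      qed (use elim in \<open>auto simp: S_iff h_def intro!: DERIV_subset[OF G]\<close>)
      then show ?case
        by (simp add: h_def norm_mult mult_ac)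
    qed
    have "((\<lambda>R. 4 * pi * B R) \<longlongrightarrow> 4 * pi * 0) at_top"
      unfolding B_def by (intro tendsto_mult tendsto_const) real_asymp
    then show "((\<lambda>R. 4 * pi * B R) \<longlongrightarrow> 0) at_top"
      by simp
  qed
  have "((\<lambda>R. (G (of_real R + h) - G (of_real R - h)) - (G h - G (- h))) \<longlongrightarrow> 0 - (G h - G (- h))) at_top"
    by (intro tendsto_diff lim2 tendsto_const)
  moreover have "\<forall>\<^sub>F R in at_top. (G (of_real R + h) - G (of_real R - h)) - (G h - G (- h)) = (LINT u:{0..R}|lborel. f u)"
    using eventually_ge_at_top[of 0] by eventually_elim (simp add: seg)
  ultimately have "((\<lambda>R. LINT u:{0..R}|lborel. f u) \<longlongrightarrow> 0 - (G h - G (- h))) at_top"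
    by (rule Lim_transform_eventually)
  then have integral: "(LINT u:{0..}|lborel. f u) = 0 - (G h - G (- h))"
    using lim1 by (intro tendsto_unique[OF trivial_limit_at_top_linorder])
  have ends: "G h - G (- h) = ((t + h) ^ Suc M - (t - h) ^ Suc M) / of_nat (Suc M) - 2 * h * t ^ M"
    using left unfolding mult_cancel_left by simp
  show ?thesis
    using integral unfolding ends by (simp add: f_def h_def del: power_Suc of_nat_Suc)
qed

section \<open>The odd primitive and its shifted difference\<close>

text \<open>The termwise primitive of \<open>LINT_power_mirzakhani_H\<close> for m = 2d + 1, using
  that \<open>appell (2 * d + 2)\<close> differentiates to (2d + 2) times
  \<open>appell (2 * d + 1)\<close>. The constant of integration is chosen to make it odd.\<close>

definition kernel_primitive :: "nat \<Rightarrow> complex \<Rightarrow> complex" where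
  "kernel_primitive d z = (z ^ (2 * d + 3) / of_nat (2 * d + 3) + appell (2 * d + 2) z - appell (2 * d + 2) (- z))
     / of_nat (2 * d + 2)"

lemma kernel_primitive_odd_powers:
  "\<exists>K p. finite K \<and> (\<forall>z. kernel_primitive d z = (\<Sum>k\<in>K. p k * z ^ (2 * k + 1)))"
proof -
  define c where "c k = of_nat (2 * d + 2 choose k) * complex_of_real (fermi_moment (2 * d + 2 - k))" for k
  \<comment> \<open>The odd part of the Appell polynomial ends in degree 2d + 1, that is k = d; the
    index k = d + 1 holds only the leading power z^(2d+3).\<close>
  define p where "p k = (2 * (if k \<le> d then c (2 * k + 1) else 0) + (if k = d + 1 then 1 / of_nat (2 * d + 3) else 0)) / of_nat (2 * d + 2)" for k
  have "kernel_primitive d z = (\<Sum>k\<le>d + 1. p k * z ^ (2 * k + 1))" for z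
  proof -
    have *: "(\<Sum>k\<le>2 * n. f k) = (\<Sum>k\<le>n. f (2 * k)) + (\<Sum>k<n. f (2 * k + 1))" for f :: "nat \<Rightarrow> complex" and n
      by (induction n) (auto simp: algebra_simps)
    have "appell (2 * d + 2) z - appell (2 * d + 2) (- z) = (\<Sum>k\<le>2 * (d + 1). c k * (z ^ k - (- z) ^ k))"
      by (simp add: appell_def c_def sum_subtractf right_diff_distrib del: sum.atMost_Suc)
    also have "\<dots> = (\<Sum>k<d + 1. c (2 * k + 1) * (2 * z ^ (2 * k + 1)))"
      unfolding * by simp
    also have "\<dots> = (\<Sum>k\<le>d. (2 * c (2 * k + 1)) * z ^ (2 * k + 1))"
      by (intro sum.cong) auto
    finally have "kernel_primitive d z = (z ^ (2 * d + 3) / of_nat (2 * d + 3) + (\<Sum>k\<le>d. (2 * c (2 * k + 1)) * z ^ (2 * k + 1))) / of_nat (2 * d + 2)"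
      unfolding kernel_primitive_def by (simp only: add_diff_eq[symmetric])
    also have "\<dots> = (\<Sum>k\<le>d + 1. p k * z ^ (2 * k + 1))"
      by (simp add: p_def add_divide_distrib sum_divide_distrib eval_nat_numeral)
    finally show ?thesis .
  qed
  then show ?thesis
    by blast
qed

text \<open>The shift \<open>r\<close> will be plus or minus a boundary length, and 0 for the double
  integrals.\<close>

lemma kernel_primitive_deriv:
  "((\<lambda>s. kernel_primitive d (of_real s + c)) has_vector_derivative
     of_real (LINT x:{0..}|lborel. x ^ (2 * d + 1) * mirzakhani_H x (t + r))) (at t within A)" if "c = of_real r"
proof -
  have 1: "(appell (2 * d + 2) has_field_derivative of_nat (2 * d + 2) * appell (2 * d + 1) z) (at z)" for z
    using appell_deriv[of "2 * d + 1" z] by simp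
  have 2: "((\<lambda>z. appell (2 * d + 2) (- z)) has_field_derivative of_nat (2 * d + 2) * appell (2 * d + 1) (- z) * - 1) (at z)" for z
    by (rule DERIV_chain2[OF 1]) (auto intro!: derivative_eq_intros)
  have 3: "((\<lambda>z. z ^ (2 * d + 3)) has_field_derivative of_nat (2 * d + 3) * z ^ (2 * d + 2)) (at z)" for z :: complex
    by (auto intro!: derivative_eq_intros)
  have 4: "(kernel_primitive d has_field_derivative
     (of_nat (2 * d + 3) * z ^ (2 * d + 2) / of_nat (2 * d + 3) + of_nat (2 * d + 2) * appell (2 * d + 1) z
       - of_nat (2 * d + 2) * appell (2 * d + 1) (- z) * - 1) / of_nat (2 * d + 2)) (at z)" for z
    unfolding kernel_primitive_def by (intro DERIV_cdivide DERIV_diff DERIV_add 1 2 3)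
  have 5: "(of_nat (2 * d + 3) * z ^ (2 * d + 2) / of_nat (2 * d + 3) + of_nat (2 * d + 2) * appell (2 * d + 1) z
       - of_nat (2 * d + 2) * appell (2 * d + 1) (- z) * - 1) / of_nat (2 * d + 2)
    = z ^ Suc (2 * d + 1) / of_nat (Suc (2 * d + 1)) + appell (2 * d + 1) z + appell (2 * d + 1) (- z)" for z
  proof -
    have "of_nat (2 * d + 3) \<noteq> (0 :: complex)" "of_nat (2 * d + 2) \<noteq> (0 :: complex)"
      unfolding of_nat_eq_0_iff by simp_all
    then show ?thesis
      by (simp add: add_divide_distrib del: of_nat_add of_nat_mult of_nat_numeral)
  qed
  have 6: "(kernel_primitive d has_field_derivative
     complex_of_real (LINT x:{0..}|lborel. x ^ (2 * d + 1) * mirzakhani_H x s)) (at (of_real s))" for s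
    using 4[of "of_real s"] unfolding 5 by (subst LINT_power_mirzakhani_H) simp_all
  have "((kernel_primitive d \<circ> (\<lambda>s. of_real s + c)) has_vector_derivative
     1 * of_real (LINT x:{0..}|lborel. x ^ (2 * d + 1) * mirzakhani_H x (t + r))) (at t within A)"
    by (rule field_vector_diff_chain_within)
      (use that DERIV_subset[OF 6[of "t + r"]] in \<open>auto intro!: derivative_eq_intros\<close>)
  then show ?thesis
    by (simp add: o_def)
qed

text \<open>As the exponent M = 2d + 2 is even, (z - s)^M equals (s - z)^M, so the half strip
  integral is a combination of four Appell values, exactly those in the difference on the left. The
  remaining term with exponent M + 1 is matched by the leading power of
  \<open>kernel_primitive\<close>.\<close>

lemma kernel_primitive_difference:
  "kernel_primitive d (z + 2 * pi * \<i>) - kernel_primitive d (z - 2 * pi * \<i>) = 4 * pi * \<i> * z ^ (2 * d + 2) / of_nat (2 * d + 2)"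
proof -
  define M where "M = 2 * d + 2"
  have "even M"
    by (simp add: M_def)
  define w where "w = complex_of_real (2 * pi) * \<i>"
  define k where "k = (\<lambda>s. (z + s) ^ M + (z - s) ^ M)"
  have terms: "(k (of_real u + w) - k (of_real u - w)) * of_real (fermi u)
    = ((z + w) + of_real u) ^ M * of_real (fermi u) + (- (z - w) + of_real u) ^ M * of_real (fermi u)
     - (((z - w) + of_real u) ^ M * of_real (fermi u) + (- (z + w) + of_real u) ^ M * of_real (fermi u))" for u
  proof -
    have "(z - (of_real u + w)) ^ M = (- (z - w) + of_real u) ^ M"
      "(z - (of_real u - w)) ^ M = (- (z + w) + of_real u) ^ M"
      using power_minus_even[OF \<open>even M\<close>, of "z - (of_real u + w)"]
        power_minus_even[OF \<open>even M\<close>, of "z - (of_real u - w)"] by (simp_all add: algebra_simps)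
    then show ?thesis
      unfolding k_def by (simp add: algebra_simps)
  qed
  note A = has_integral_appell[of _ M]
  have int: "set_integrable lborel {0..} (\<lambda>u. (k (of_real u + w) - k (of_real u - w)) * of_real (fermi u))"
    unfolding terms by (intro set_integral_diff(1) set_integral_add(1) A)
  have "(LINT u:{0..}|lborel. (k (of_real u + w) - k (of_real u - w)) * of_real (fermi u))
    = (appell M (z + w) + appell M (- (z - w))) - (appell M (z - w) + appell M (- (z + w)))"
    unfolding terms
    by (subst set_integral_diff(2); (intro set_integral_add(1) A)?)
      (simp_all only: set_integral_add(2)[OF A(1) A(1)] A(2))
  also have "(LINT u:{0..}|lborel. (k (of_real u + w) - k (of_real u - w)) * of_real (fermi u))
    = 4 * pi * \<i> * z ^ M - ((z + w) ^ Suc M - (z - w) ^ Suc M) / of_nat (Suc M)"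
    using half_strip_integral[of z M] int by (simp add: k_def w_def)
  finally have *: "(appell M (z + w) + appell M (- (z - w))) - (appell M (z - w) + appell M (- (z + w)))
     + ((z + w) ^ Suc M - (z - w) ^ Suc M) / of_nat (Suc M) = 4 * pi * \<i> * z ^ M"
    by (metis diff_add_cancel)
  have "kernel_primitive d (z + w) - kernel_primitive d (z - w)
     = ((appell M (z + w) + appell M (- (z - w))) - (appell M (z - w) + appell M (- (z + w)))
     + ((z + w) ^ Suc M - (z - w) ^ Suc M) / of_nat (Suc M)) / of_nat M"
    unfolding kernel_primitive_def M_def[symmetric]
    by (simp add: M_def add_divide_distrib diff_divide_distrib eval_nat_numeral)
  then show ?thesis
    unfolding * by (simp add: w_def M_def)
qed

section \<open>Reduction of double integrals\<close>

text \<open>The Beta value B(p + 1, q + 1).\<close>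

definition beta_coeff :: "nat \<Rightarrow> nat \<Rightarrow> real" where
  "beta_coeff p q = (LINT x:{0..1}|lborel. x ^ p * (1 - x) ^ q)"

lemma beta_coeff_nonneg: "beta_coeff p q \<ge> 0"
  unfolding beta_coeff_def set_lebesgue_integral_def
  by (intro Bochner_Integration.integral_nonneg) (auto simp: indicator_def)

lemma nn_integral_beta_coeff:
  assumes "s \<ge> 0"
  shows "(\<integral>\<^sup>+x. ennreal (indicator {0..s} x * (x ^ p * (s - x) ^ q)) \<partial>lborel) = ennreal (s ^ (p + q + 1) * beta_coeff p q)"
proof (cases "s = 0")
  \<comment> \<open>For s = 0 the substitution x = s x' degenerates, but the interval is a null set
    and the right-hand side is 0.\<close>
  case True
  have "AE x in lborel. ennreal (indicator {0..s} x * (x ^ p * (s - x) ^ q)) = 0"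
    using AE_lborel_singleton[of "0 :: real"] by eventually_elim (auto simp: True indicator_def)
  then have "(\<integral>\<^sup>+x. ennreal (indicator {0..s} x * (x ^ p * (s - x) ^ q)) \<partial>lborel) = 0"
    by (subst nn_integral_0_iff_AE) simp_all
  then show ?thesis
    by (simp add: True)
next
  case False
  with assms have s: "s > 0"
    by simp
  have *: "indicator {0..s} (0 + s * x) * ((0 + s * x) ^ p * (s - (0 + s * x)) ^ q)
     = s ^ (p + q) * (indicator {0..1} x * (x ^ p * (1 - x) ^ q))" for x
  proof -
    have "s - s * x = s * (1 - x)"
      by (simp add: algebra_simps)
    moreover have "0 \<le> s * x \<and> s * x \<le> s \<longleftrightarrow> 0 \<le> x \<and> x \<le> 1"
      using s by (simp add: zero_le_mult_iff)
    ultimately show ?thesis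
      by (simp add: indicator_def power_mult_distrib power_add)
  qed
  have "(\<integral>\<^sup>+x. ennreal (indicator {0..s} x * (x ^ p * (s - x) ^ q)) \<partial>lborel)
     = s * (\<integral>\<^sup>+x. ennreal (s ^ (p + q) * (indicator {0..1} x * (x ^ p * (1 - x) ^ q))) \<partial>lborel)"
    by (subst nn_integral_real_affine[where c = s and t = 0]) (use s in \<open>simp_all only: *, simp_all\<close>)
  also have "\<dots> = ennreal s * (ennreal (s ^ (p + q)) * (\<integral>\<^sup>+x. ennreal (indicator {0..1} x * (x ^ p * (1 - x) ^ q)) \<partial>lborel))"
    using s by (subst nn_integral_cmult[symmetric]) (auto simp: indicator_def ennreal_mult intro!: nn_integral_cong)
  also have "(\<integral>\<^sup>+x. ennreal (indicator {0..1} x * (x ^ p * (1 - x) ^ q)) \<partial>lborel) = ennreal (beta_coeff p q)"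
  proof -
    have "set_integrable lborel {0..1} (\<lambda>x::real. x ^ p * (1 - x) ^ q)"
      by (intro borel_integrable_atLeastAtMost' continuous_intros)
    then show ?thesis
      unfolding beta_coeff_def set_lebesgue_integral_def set_integrable_def
      by (subst nn_integral_eq_integral) (auto simp: indicator_def)
  qed
  finally show ?thesis
    using s by (simp add: ennreal_mult[symmetric] beta_coeff_nonneg mult_ac)
qed

text \<open>Captures what H and the indicator of a half line have in common. Nonnegativity makes
  Tonelli applicable before integrability on the quadrant is known.\<close>

definition moment_weight :: "(real \<Rightarrow> real) \<Rightarrow> bool" where
  "moment_weight \<phi> \<longleftrightarrow> \<phi> \<in> borel_measurable borel \<and> (\<forall>s. \<phi> s \<ge> 0) \<and> (\<forall>k. set_integrable lborel {0..} (\<lambda>s. s ^ k * \<phi> s))"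

text \<open>With s = x + y as new variable and the order exchanged, the inner integral over 0 \<le>
  x \<le> s is a scaled Beta integral. Computing with nonnegative integrals yields integrability and
  the value together.\<close>

lemma monomial_pair_integral:
  fixes \<phi> :: "real \<Rightarrow> real"
  assumes "moment_weight \<phi>"
  shows "set_integrable lborel ({0..} \<times> {0..}) (\<lambda>(x, y). x ^ p * y ^ q * \<phi> (x + y))" (is ?int)
    and "(LINT (x, y):{0..} \<times> {0..}|lborel. x ^ p * y ^ q * \<phi> (x + y))
       = beta_coeff p q * (LINT s:{0..}|lborel. s ^ (p + q + 1) * \<phi> s)" (is ?eq)
proof -
  have [measurable]: "\<phi> \<in> borel_measurable borel" and \<phi>: "\<And>s. \<phi> s \<ge> 0"
    and int: "set_integrable lborel {0..} (\<lambda>s. s ^ (p + q + 1) * \<phi> s)"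
    using assms unfolding moment_weight_def by blast+
  define F where "F x y = indicator {0..} x * (indicator {0..} y * (x ^ p * y ^ q * \<phi> (x + y)))" for x y
  have F: "indicator ({0..} \<times> {0..}) z *\<^sub>R (\<lambda>(x, y). x ^ p * y ^ q * \<phi> (x + y)) z = (\<lambda>(x, y). F x y) z" for z
    by (cases z) (simp add: F_def indicator_def)
  have F_nonneg: "F x y \<ge> 0" for x y
    by (auto simp: F_def indicator_def \<phi>)
  have F_meas [measurable]: "(\<lambda>z. F (fst z) (snd z)) \<in> borel_measurable (borel \<Otimes>\<^sub>M borel)"
    unfolding F_def by measurable
  have "(\<integral>\<^sup>+z. ennreal (F (fst z) (snd z)) \<partial>(lborel \<Otimes>\<^sub>M lborel))
      = (\<integral>\<^sup>+x. \<integral>\<^sup>+y. ennreal (F x y) \<partial>lborel \<partial>lborel)"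
    by (subst lborel.nn_integral_fst[symmetric]) auto
  also have "\<dots> = (\<integral>\<^sup>+x. \<integral>\<^sup>+s. ennreal (F x (- x + 1 * s)) \<partial>lborel \<partial>lborel)"
  proof (rule nn_integral_cong)
    show "(\<integral>\<^sup>+y. ennreal (F x y) \<partial>lborel) = (\<integral>\<^sup>+s. ennreal (F x (- x + 1 * s)) \<partial>lborel)" for x
      by (subst nn_integral_real_affine[where c = 1 and t = "- x"]) (auto simp: F_def)
  qed
  also have "\<dots> = (\<integral>\<^sup>+s. \<integral>\<^sup>+x. ennreal (F x (- x + 1 * s)) \<partial>lborel \<partial>lborel)"
    by (intro lborel_pair.Fubini') (simp add: F_def)
  also have "\<dots> = (\<integral>\<^sup>+s. ennreal (indicator {0..} s * (s ^ (p + q + 1) * \<phi> s)) * ennreal (beta_coeff p q) \<partial>lborel)"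
  proof (rule nn_integral_cong)
    fix s :: real
    have "F x (- x + 1 * s) = indicator {0..} s * \<phi> s * (indicator {0..s} x * (x ^ p * (s - x) ^ q))" for x
      by (auto simp: F_def indicator_def)
    then have "(\<integral>\<^sup>+x. ennreal (F x (- x + 1 * s)) \<partial>lborel)
       = (\<integral>\<^sup>+x. ennreal (indicator {0..} s * \<phi> s) * ennreal (indicator {0..s} x * (x ^ p * (s - x) ^ q)) \<partial>lborel)"
      by (simp add: ennreal_mult' \<phi>)
    also have "\<dots> = ennreal (indicator {0..} s * \<phi> s) * (\<integral>\<^sup>+x. ennreal (indicator {0..s} x * (x ^ p * (s - x) ^ q)) \<partial>lborel)"
      by (rule nn_integral_cmult) simp
    also have "\<dots> = ennreal (indicator {0..} s * (s ^ (p + q + 1) * \<phi> s)) * ennreal (beta_coeff p q)"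
    proof (cases "s \<ge> 0")
      case True
      then show ?thesis
        by (subst nn_integral_beta_coeff) (simp_all add: ennreal_mult[symmetric] \<phi> beta_coeff_nonneg mult_ac)
    qed simp
    finally show "(\<integral>\<^sup>+x. ennreal (F x (- x + 1 * s)) \<partial>lborel) = \<dots>" .
  qed
  also have "\<dots> = (\<integral>\<^sup>+s. ennreal (indicator {0..} s * (s ^ (p + q + 1) * \<phi> s)) \<partial>lborel) * ennreal (beta_coeff p q)"
    by (rule nn_integral_multc) simp
  also have "\<dots> = ennreal (LINT s:{0..}|lborel. s ^ (p + q + 1) * \<phi> s) * ennreal (beta_coeff p q)"
    using int unfolding set_lebesgue_integral_def set_integrable_def
    by (subst nn_integral_eq_integral) (auto simp: indicator_def \<phi>)
  also have "\<dots> = ennreal (beta_coeff p q * (LINT s:{0..}|lborel. s ^ (p + q + 1) * \<phi> s))"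
    by (simp add: ennreal_mult' beta_coeff_nonneg mult.commute)
  finally have nn: "(\<integral>\<^sup>+z. ennreal (F (fst z) (snd z)) \<partial>lborel)
     = ennreal (beta_coeff p q * (LINT s:{0..}|lborel. s ^ (p + q + 1) * \<phi> s))"
    by (simp add: lborel_prod)
  have nonneg: "(LINT s:{0..}|lborel. s ^ (p + q + 1) * \<phi> s) \<ge> 0"
    unfolding set_lebesgue_integral_def
    by (intro Bochner_Integration.integral_nonneg) (auto simp: indicator_def \<phi>)
  have F_meas': "(\<lambda>z. F (fst z) (snd z)) \<in> borel_measurable (lborel :: (real \<times> real) measure)"
    using F_meas by (simp add: borel_prod)
  have "integrable lborel (\<lambda>z. F (fst z) (snd z))"
    by (rule integrableI_nn_integral_finite[OF F_meas' _ nn])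
      (auto simp: F_nonneg)
  then show ?int
    unfolding set_integrable_def F by (simp add: case_prod_unfold)
  have "(LINT (x, y):{0..} \<times> {0..}|lborel. x ^ p * y ^ q * \<phi> (x + y)) = (LINT z|lborel. F (fst z) (snd z))"
    unfolding set_lebesgue_integral_def F by (simp add: case_prod_unfold)
  also have "\<dots> = enn2real (\<integral>\<^sup>+z. ennreal (F (fst z) (snd z)) \<partial>lborel)"
    by (rule integral_eq_nn_integral[OF F_meas']) (simp add: F_nonneg)
  finally show ?eq
    unfolding nn using nonneg by (simp only: enn2real_ennreal mult_nonneg_nonneg beta_coeff_nonneg)
qed

lemma even_poly_weight_integrable:
  assumes "even_poly (Suc n) v" "moment_weight \<phi>" "length bs = n"
  shows "set_integrable lborel {0..} (\<lambda>s. of_real s * v (of_real s # bs) * of_real (\<phi> s))"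
  using assms(1)
proof (induction rule: even_poly_Suc_induct)
  case (monomial a d)
  have "set_integrable lborel {0..} (\<lambda>s. complex_of_real (s ^ (2 * d + 1) * \<phi> s))"
    using assms(2) unfolding moment_weight_def by (intro set_integrable_complex_of_real) blast
  then have "set_integrable lborel {0..} (\<lambda>s. a bs * complex_of_real (s ^ (2 * d + 1) * \<phi> s))"
    by simp
  then show ?case
    by (simp add: mult_ac)
next
  case (add f g)
  from set_integral_add(1)[OF this] show ?case
    by (simp add: algebra_simps)
next
  case (cong f g)
  then show ?case
    using assms(3) by simp
qed

section \<open>From two integration variables to one\<close>

text \<open>The polynomial \<open>v\<close> does not depend on the weight \<open>\<phi>\<close>: one
  and the same \<open>v\<close> serves the kernel H of the recursion and the indicator that
  describes the triangle.\<close>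

definition diagonal_reduction :: "nat \<Rightarrow> (complex list \<Rightarrow> complex) \<Rightarrow> (complex list \<Rightarrow> complex) \<Rightarrow> bool" where
  "diagonal_reduction n u v \<longleftrightarrow> even_poly (Suc n) v \<and>
    (\<forall>\<phi> bs. moment_weight \<phi> \<longrightarrow> length bs = n \<longrightarrow>
      set_integrable lborel ({0..} \<times> {0..})
        (\<lambda>(x, y). of_real (x * y) * u (of_real x # of_real y # bs) * of_real (\<phi> (x + y))) \<and>
      (LINT (x, y):{0..} \<times> {0..}|lborel. of_real (x * y) * u (of_real x # of_real y # bs) * of_real (\<phi> (x + y)))
        = (LINT s:{0..}|lborel. of_real s * v (of_real s # bs) * of_real (\<phi> s)))"

lemma diagonal_reduction_add:
  assumes "diagonal_reduction n u v" "diagonal_reduction n u' v'"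
  shows "diagonal_reduction n (\<lambda>zs. u zs + u' zs) (\<lambda>zs. v zs + v' zs)"
  unfolding diagonal_reduction_def
proof (intro conjI allI impI)
  have ev: "even_poly (Suc n) v" "even_poly (Suc n) v'"
    using assms by (auto simp: diagonal_reduction_def)
  then show "even_poly (Suc n) (\<lambda>zs. v zs + v' zs)"
    by (rule even_poly.add)
  fix \<phi> and bs :: "complex list"
  assume \<phi>: "moment_weight \<phi>" and bs: "length bs = n"
  let ?f = "\<lambda>u (x, y). of_real (x * y) * u (of_real x # of_real y # bs) * of_real (\<phi> (x + y)) :: complex"
  let ?g = "\<lambda>v s. of_real s * v (of_real s # bs) * of_real (\<phi> s) :: complex"
  have f: "set_integrable lborel ({0..} \<times> {0..}) (?f u)" "set_integrable lborel ({0..} \<times> {0..}) (?f u')"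
    and fg: "(LINT z:{0..} \<times> {0..}|lborel. ?f u z) = (LINT s:{0..}|lborel. ?g v s)"
      "(LINT z:{0..} \<times> {0..}|lborel. ?f u' z) = (LINT s:{0..}|lborel. ?g v' s)"
    using assms \<phi> bs by (auto simp: diagonal_reduction_def)
  have eq: "?f (\<lambda>zs. u zs + u' zs) = (\<lambda>z. ?f u z + ?f u' z)" "?g (\<lambda>zs. v zs + v' zs) = (\<lambda>s. ?g v s + ?g v' s)"
    by (auto simp: fun_eq_iff algebra_simps)
  show "set_integrable lborel ({0..} \<times> {0..}) (?f (\<lambda>zs. u zs + u' zs))"
    unfolding eq by (intro set_integral_add(1) f)
  show "(LINT z:{0..} \<times> {0..}|lborel. ?f (\<lambda>zs. u zs + u' zs) z) = (LINT s:{0..}|lborel. ?g (\<lambda>zs. v zs + v' zs) s)"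
    unfolding eq set_integral_add(2)[OF f] fg
    by (rule set_integral_add(2)[symmetric]) (intro even_poly_weight_integrable[OF _ \<phi> bs] ev)+
qed

text \<open>The factor x y makes the exponents odd, so the reduced power is s^(2d+2e+3), which is s
  times an even power.\<close>

lemma diagonal_reduction_monomial:
  assumes "even_poly n a"
  shows "diagonal_reduction n (\<lambda>zs. a (tl (tl zs)) * hd (tl zs) ^ (2 * e) * hd zs ^ (2 * d))
    (\<lambda>zs. a (tl zs) * of_real (beta_coeff (2 * d + 1) (2 * e + 1)) * (zs ! 0) ^ (2 * (d + e + 1)))"
  unfolding diagonal_reduction_def
proof (intro conjI allI impI)
  show "even_poly (Suc n) (\<lambda>zs. a (tl zs) * of_real (beta_coeff (2 * d + 1) (2 * e + 1)) * (zs ! 0) ^ (2 * (d + e + 1)))"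
    by (intro even_poly.mult even_poly_tl even_poly_even_power even_poly.const assms) simp
  fix \<phi> and bs :: "complex list"
  assume \<phi>: "moment_weight \<phi>" and bs: "length bs = n"
  let ?f = "\<lambda>(x, y). x ^ (2 * d + 1) * y ^ (2 * e + 1) * \<phi> (x + y)"
  note I = monomial_pair_integral[OF \<phi>, of "2 * d + 1" "2 * e + 1"]
  have eq: "(\<lambda>(x, y). of_real (x * y) * (a (tl (tl (of_real x # of_real y # bs))) * hd (tl (of_real x # of_real y # bs)) ^ (2 * e) *
                hd (of_real x # of_real y # bs) ^ (2 * d)) * of_real (\<phi> (x + y)))
     = (\<lambda>z. a bs * complex_of_real (?f z))"
    by (auto simp: fun_eq_iff mult_ac)
  have int: "set_integrable lborel ({0..} \<times> {0..}) (\<lambda>z. complex_of_real (?f z))"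
    by (intro set_integrable_complex_of_real I(1))
  show "set_integrable lborel ({0..} \<times> {0..}) (\<lambda>(x, y). of_real (x * y) * (a (tl (tl (of_real x # of_real y # bs))) * hd (tl (of_real x # of_real y # bs)) ^ (2 * e) *
                hd (of_real x # of_real y # bs) ^ (2 * d)) * of_real (\<phi> (x + y)))"
    unfolding eq by (intro set_integrable_mult_right int)
  have "(LINT z:{0..} \<times> {0..}|lborel. a bs * complex_of_real (?f z)) = a bs * of_real (beta_coeff (2 * d + 1) (2 * e + 1)) *
      of_real (LINT s:{0..}|lborel. s ^ (2 * d + 1 + (2 * e + 1) + 1) * \<phi> s)"
    unfolding set_integral_mult_right set_integral_complex_of_real I(2) by simp
  also have "\<dots> = (LINT s:{0..}|lborel. of_real s * (a (tl (of_real s # bs)) * of_real (beta_coeff (2 * d + 1) (2 * e + 1)) * ((of_real s # bs) ! 0) ^ (2 * (d + e + 1))) * of_real (\<phi> s))"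
    unfolding set_integral_complex_of_real[symmetric] set_integral_mult_right[symmetric]
    by (intro set_lebesgue_integral_cong) (auto simp: mult_ac)
  finally show "(LINT (x, y):{0..} \<times> {0..}|lborel. of_real (x * y) * (a (tl (tl (of_real x # of_real y # bs))) * hd (tl (of_real x # of_real y # bs)) ^ (2 * e) *
                hd (of_real x # of_real y # bs) ^ (2 * d)) * of_real (\<phi> (x + y)))
     = (LINT s:{0..}|lborel. of_real s * (a (tl (of_real s # bs)) * of_real (beta_coeff (2 * d + 1) (2 * e + 1)) * ((of_real s # bs) ! 0) ^ (2 * (d + e + 1))) * of_real (\<phi> s))"
    unfolding eq .
qed

lemma diagonal_reduction_exists:
  assumes "even_poly (Suc (Suc n)) u"
  shows "\<exists>v. diagonal_reduction n u v"
  using assms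
proof (induction rule: even_poly_Suc_induct)
  case (monomial a d)
  then show ?case
  \<comment> \<open>The coefficient of the first variable is expanded in turn in the second
    variable.\<close>
  proof (induction rule: even_poly_Suc_induct)
    case (monomial a e)
    then show ?case
      by (blast intro: diagonal_reduction_monomial)
  next
    case (add f g)
    then obtain v v' where "diagonal_reduction n (\<lambda>zs. f (tl zs) * hd zs ^ (2 * d)) v"
      "diagonal_reduction n (\<lambda>zs. g (tl zs) * hd zs ^ (2 * d)) v'"
      by blast
    from diagonal_reduction_add[OF this] show ?case
      unfolding distrib_right by blast
  next
    case (cong f g)
    then show ?case
      by (auto simp: diagonal_reduction_def)
  qed
next
  case (add f g)
  then show ?case
    by (blast intro: diagonal_reduction_add)
next
  case (cong f g)
  then show ?case
    by (auto simp: diagonal_reduction_def)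
qed

section \<open>Primitives for even polynomials\<close>

lemma moment_weight_mirzakhani_H: "moment_weight (\<lambda>s. mirzakhani_H s t)"
  unfolding moment_weight_def
  using set_integrable_power_mirzakhani_H(2)
  by (auto simp: mirzakhani_H_eq intro!: add_nonneg_nonneg less_imp_le[OF fermi_pos])

text \<open>Evaluated at x + y, this weight cuts the quadrant down to the triangle x + y \<le>
  b.\<close>

lemma moment_weight_indicator: "moment_weight (indicator {..b})"
  unfolding moment_weight_def
proof (intro conjI allI)
  show "set_integrable lborel {0..} (\<lambda>s. s ^ k * indicator {..b} s)" for k
  proof -
    have "set_integrable lborel {0..b} (\<lambda>s. s ^ k)"
      by (intro borel_integrable_atLeastAtMost' continuous_intros)
    moreover have "indicator {0..} s *\<^sub>R (s ^ k * indicator {..b} s) = indicator {0..b} s *\<^sub>R s ^ k" for s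
      by (auto simp: indicator_def)
    ultimately show ?thesis
      unfolding set_integrable_def by (simp only:)
  qed
qed auto

lemma LINT_indicator_atMost:
  fixes f :: "real \<Rightarrow> complex"
  assumes "b \<ge> 0"
  shows "(LINT s:{0..}|lborel. f s * of_real (indicator {..b} s)) = (LBINT s=0..b. f s)"
proof -
  have "indicator {0..} s *\<^sub>R (f s * of_real (indicator {..b} s)) = indicator {0..b} s *\<^sub>R f s" for s
    by (auto simp: indicator_def)
  moreover have "(LBINT s=0..b. f s) = (LINT s:{0..b}|lborel. f s)"
    using interval_integral_Icc[of 0 b f] assms by (simp add: zero_ereal_def)
  ultimately show ?thesis
    unfolding set_lebesgue_integral_def by (simp only:)
qed

lemma even_poly_continuous_Cons:
  assumes "even_poly (Suc n) v" "length bs = n"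
  shows "continuous_on S (\<lambda>x. complex_of_real x * v (of_real x # bs))"
proof (intro continuous_intros even_poly_continuous[OF assms(1)])
  show "continuous_on S (\<lambda>x. (complex_of_real x # bs) ! i)" for i
    by (cases i) (auto intro!: continuous_intros)
qed (use assms(2) in simp)

text \<open>\<open>A\<close> is the odd primitive belonging to \<open>v\<close>. Oddness is recorded
  through \<open>X\<close>, the even polynomial quotient of the symmetric sum by z; the difference
  equation is required at every real \<open>t\<close> because b - b_j may be negative.\<close>

definition mirzakhani_primitive ::
    "nat \<Rightarrow> (complex list \<Rightarrow> complex) \<Rightarrow> (complex \<Rightarrow> complex list \<Rightarrow> complex) \<Rightarrow> (complex list \<Rightarrow> complex) \<Rightarrow> bool" where
  "mirzakhani_primitive n v A X \<longleftrightarrow> even_poly (Suc n) v \<and> even_poly (Suc (Suc n)) X \<and>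
    (\<forall>bs. length bs = n \<longrightarrow>
      (\<forall>z w. A (z + w) bs + A (z - w) bs = z * X (z # w # bs)) \<and>
      (\<forall>r t. ((\<lambda>s. A (of_real s + of_real r) bs) has_vector_derivative
          (LINT x:{0..}|lborel. of_real x * v (of_real x # bs) * of_real (mirzakhani_H x (t + r)))) (at t)) \<and>
      (\<forall>t. A (of_real t + 2 * pi * \<i>) bs - A (of_real t - 2 * pi * \<i>) bs
          = 4 * pi * \<i> * (LBINT x=0..t. of_real x * v (of_real x # bs))))"

text \<open>With p = z + w and q = z - w, the sums p^(2k+1) + q^(2k+1) satisfy a two-term recurrence
  with coefficients p^2 + q^2 = 2(z^2 + w^2) and -(p q)^2 = -(z^2 - w^2)^2. These are even in z and
  w, so divisibility by z with an even quotient propagates from k = 0 and k = 1.\<close>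

lemma odd_power_sum_even_poly:
  "\<exists>E. even_poly (Suc (Suc n)) E \<and>
    (\<forall>z w bs. (z + w) ^ (2 * k + 1) + (z - w) ^ (2 * k + 1) = z * E (z # w # bs))"
proof (induction k rule: induct_nat_012)
  case 0
  show ?case
    by (intro exI[of _ "\<lambda>_. 2"]) (auto intro: even_poly_intros)
next
  case 1
  have "even_poly (Suc (Suc n)) (\<lambda>zs. 2 * (zs ! 0)\<^sup>2 + 6 * (zs ! 1)\<^sup>2)"
    by (intro even_poly_intros) auto
  then show ?case
    by (intro exI[of _ "\<lambda>zs. 2 * (zs ! 0)\<^sup>2 + 6 * (zs ! 1)\<^sup>2"])
      (auto simp: power2_eq_square power3_eq_cube algebra_simps)
next
  case (ge2 k)
  then obtain E E' where E: "even_poly (Suc (Suc n)) E" "even_poly (Suc (Suc n)) E'"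
    "\<And>z w bs. (z + w) ^ (2 * k + 1) + (z - w) ^ (2 * k + 1) = z * E (z # w # bs)"
    "\<And>z w bs. (z + w) ^ (2 * Suc k + 1) + (z - w) ^ (2 * Suc k + 1) = z * E' (z # w # bs)"
    by blast
  define F where "F = (\<lambda>zs. 2 * ((zs ! 0)\<^sup>2 + (zs ! 1)\<^sup>2) * E' zs
      + (- 1) * (((zs ! 0)\<^sup>2 + (- 1) * (zs ! 1)\<^sup>2) ^ 2) * E zs)"
  have "even_poly (Suc (Suc n)) F"
    unfolding F_def by (intro even_poly_intros even_poly_power E) auto
  moreover have "(z + w) ^ (2 * Suc (Suc k) + 1) + (z - w) ^ (2 * Suc (Suc k) + 1) = z * F (z # w # bs)" for z w bs
  proof -
    have "z * F (z # w # bs) = 2 * (z\<^sup>2 + w\<^sup>2) * (z * E' (z # w # bs)) - (z\<^sup>2 - w\<^sup>2)\<^sup>2 * (z * E (z # w # bs))"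
      by (simp add: F_def algebra_simps)
    also have "\<dots> = 2 * (z\<^sup>2 + w\<^sup>2) * ((z + w)\<^sup>2 * (z + w) ^ (2 * k + 1) + (z - w)\<^sup>2 * (z - w) ^ (2 * k + 1))
        - (z\<^sup>2 - w\<^sup>2)\<^sup>2 * ((z + w) ^ (2 * k + 1) + (z - w) ^ (2 * k + 1))"
      unfolding E(3,4)[symmetric] by (simp add: power2_eq_square mult_ac)
    also have "\<dots> = (z + w) ^ 4 * (z + w) ^ (2 * k + 1) + (z - w) ^ 4 * (z - w) ^ (2 * k + 1)"
    proof -
      have "2 * (z\<^sup>2 + w\<^sup>2) * (p\<^sup>2 * a + q\<^sup>2 * b) - (z\<^sup>2 - w\<^sup>2)\<^sup>2 * (a + b) = p ^ 4 * a + q ^ 4 * b"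
        if "p = z + w" "q = z - w" for p q a b
        unfolding that by algebra
      then show ?thesis
        by blast
    qed
    also have "\<dots> = (z + w) ^ (2 * Suc (Suc k) + 1) + (z - w) ^ (2 * Suc (Suc k) + 1)"
      by (simp flip: power_add add: eval_nat_numeral)
    finally show ?thesis
      by simp
  qed
  ultimately show ?case
    by blast
qed

lemma mirzakhani_primitive_add:
  assumes "mirzakhani_primitive n v A X" "mirzakhani_primitive n v' A' X'"
  shows "mirzakhani_primitive n (\<lambda>zs. v zs + v' zs) (\<lambda>z bs. A z bs + A' z bs) (\<lambda>zs. X zs + X' zs)"
  unfolding mirzakhani_primitive_def
proof (intro conjI allI impI)
  have v: "even_poly (Suc n) v" "even_poly (Suc n) v'"
    using assms by (auto simp: mirzakhani_primitive_def)
  then show "even_poly (Suc n) (\<lambda>zs. v zs + v' zs)"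
    by (rule even_poly.add)
  show "even_poly (Suc (Suc n)) (\<lambda>zs. X zs + X' zs)"
    using assms by (auto simp: mirzakhani_primitive_def intro: even_poly.add)
  fix bs :: "complex list" assume bs: "length bs = n"
  note * = assms[unfolded mirzakhani_primitive_def, THEN conjunct2, THEN conjunct2, rule_format, OF bs]
  show "A (z + w) bs + A' (z + w) bs + (A (z - w) bs + A' (z - w) bs) = z * (X (z # w # bs) + X' (z # w # bs))" for z w
    using *(1)[THEN conjunct1, rule_format, of z w] *(2)[THEN conjunct1, rule_format, of z w] by (simp add: algebra_simps)
  show "((\<lambda>s. A (of_real s + of_real r) bs + A' (of_real s + of_real r) bs) has_vector_derivative
     (LINT x:{0..}|lborel. of_real x * (v (of_real x # bs) + v' (of_real x # bs)) * of_real (mirzakhani_H x (t + r)))) (at t)" for r t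
    unfolding distrib_left distrib_right
    by (subst set_integral_add(2)) (use * in \<open>auto intro!: has_vector_derivative_add
      even_poly_weight_integrable[OF _ moment_weight_mirzakhani_H bs] v\<close>)
  show "A (of_real t + 2 * pi * \<i>) bs + A' (of_real t + 2 * pi * \<i>) bs
      - (A (of_real t - 2 * pi * \<i>) bs + A' (of_real t - 2 * pi * \<i>) bs)
      = 4 * pi * \<i> * (LBINT x=0..t. of_real x * (v (of_real x # bs) + v' (of_real x # bs)))" for t
  proof -
    have int: "interval_lebesgue_integrable lborel (ereal 0) (ereal t) (\<lambda>x. complex_of_real x * f (of_real x # bs))"
      if "even_poly (Suc n) f" for f
      using even_poly_continuous_Cons[OF that bs, of UNIV]
      by (intro interval_integrable_isCont) (simp add: continuous_on_eq_continuous_at)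
    show ?thesis
      using *(1)[THEN conjunct2, THEN conjunct2, rule_format, of t] *(2)[THEN conjunct2, THEN conjunct2, rule_format, of t]
      unfolding distrib_left zero_ereal_def
      by (subst interval_lebesgue_integral_add(2)[OF int int]) (simp_all add: v algebra_simps)
  qed
qed

lemma mirzakhani_primitive_monomial:
  assumes "even_poly n a"
  shows "\<exists>X. mirzakhani_primitive n (\<lambda>zs. a (tl zs) * hd zs ^ (2 * d)) (\<lambda>z bs. a bs * kernel_primitive d z) X"
proof -
  obtain K p where K: "finite K" "\<And>z. kernel_primitive d z = (\<Sum>k\<in>K. p k * z ^ (2 * k + 1))"
    using kernel_primitive_odd_powers by blast
  obtain E where E: "\<And>k. even_poly (Suc (Suc n)) (E k)"
    "\<And>k z w bs. (z + w) ^ (2 * k + 1) + (z - w) ^ (2 * k + 1) = z * E k (z # w # bs)"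
    using odd_power_sum_even_poly[of n] by metis
  have "mirzakhani_primitive n (\<lambda>zs. a (tl zs) * hd zs ^ (2 * d)) (\<lambda>z bs. a bs * kernel_primitive d z)
    (\<lambda>zs. a (tl (tl zs)) * (\<Sum>k\<in>K. p k * E k zs))"
    unfolding mirzakhani_primitive_def
  proof (intro conjI allI impI)
    have "even_poly (Suc n) (\<lambda>zs. a (tl zs) * (zs ! 0) ^ (2 * d))"
      by (intro even_poly.mult even_poly_tl even_poly_even_power assms) simp
    then show "even_poly (Suc n) (\<lambda>zs. a (tl zs) * hd zs ^ (2 * d))"
      by (rule even_poly.cong) (auto simp: length_Suc_conv)
    show "even_poly (Suc (Suc n)) (\<lambda>zs. a (tl (tl zs)) * (\<Sum>k\<in>K. p k * E k zs))"
      by (intro even_poly.mult even_poly_sum even_poly.const E even_poly_tl[of "Suc n" "\<lambda>zs. a (tl zs)"] even_poly_tl assms)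
    fix bs :: "complex list" assume bs: "length bs = n"
    show "a bs * kernel_primitive d (z + w) + a bs * kernel_primitive d (z - w)
       = z * (a (tl (tl (z # w # bs))) * (\<Sum>k\<in>K. p k * E k (z # w # bs)))" for z w
    proof -
      have "kernel_primitive d (z + w) + kernel_primitive d (z - w)
         = (\<Sum>k\<in>K. p k * ((z + w) ^ (2 * k + 1) + (z - w) ^ (2 * k + 1)))"
        by (simp only: K sum.distrib distrib_left)
      also have "\<dots> = z * (\<Sum>k\<in>K. p k * E k (z # w # bs))"
        unfolding E(2)[where bs = bs] sum_distrib_left by (intro sum.cong) auto
      finally show ?thesis
        by (simp flip: distrib_left)
    qed
    show "((\<lambda>s. a bs * kernel_primitive d (of_real s + of_real r)) has_vector_derivative
      (LINT x:{0..}|lborel. of_real x * (a (tl (of_real x # bs)) * hd (of_real x # bs) ^ (2 * d)) * of_real (mirzakhani_H x (t + r)))) (at t)" for r t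
    proof -
      have "(LINT x:{0..}|lborel. of_real x * (a (tl (of_real x # bs)) * hd (of_real x # bs) ^ (2 * d)) * of_real (mirzakhani_H x (t + r)))
        = a bs * of_real (LINT x:{0..}|lborel. x ^ (2 * d + 1) * mirzakhani_H x (t + r))"
        unfolding set_integral_complex_of_real[symmetric] set_integral_mult_right[symmetric]
        by (intro set_lebesgue_integral_cong) (auto simp: mult_ac)
      then show ?thesis
        by (simp only:) (intro has_vector_derivative_mult_right kernel_primitive_deriv refl)
    qed
    show "a bs * kernel_primitive d (of_real t + 2 * pi * \<i>) - a bs * kernel_primitive d (of_real t - 2 * pi * \<i>)
      = 4 * pi * \<i> * (LBINT x=0..t. of_real x * (a (tl (of_real x # bs)) * hd (of_real x # bs) ^ (2 * d)))" for t
    proof -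
      have D: "((\<lambda>x. a bs * of_real x ^ (2 * d + 2) / of_nat (2 * d + 2)) has_vector_derivative
          of_real x * (a bs * of_real x ^ (2 * d))) (at x within A)" for x :: real and A
      proof -
        have "((\<lambda>z. a bs * z ^ (2 * d + 2) / of_nat (2 * d + 2)) has_field_derivative
            z * (a bs * z ^ (2 * d))) (at z)" for z
        proof (rule DERIV_cong)
          show "((\<lambda>z. a bs * z ^ (2 * d + 2) / of_nat (2 * d + 2)) has_field_derivative
              a bs * (of_nat (2 * d + 2) * (1 * z ^ (2 * d + 2 - Suc 0))) / of_nat (2 * d + 2)) (at z)"
            by (intro DERIV_cdivide DERIV_cmult DERIV_power DERIV_ident)
          have "of_nat (2 * d + 2) \<noteq> (0 :: complex)"
            unfolding of_nat_eq_0_iff by simp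
          then show "a bs * (of_nat (2 * d + 2) * (1 * z ^ (2 * d + 2 - Suc 0))) / of_nat (2 * d + 2) = z * (a bs * z ^ (2 * d))"
            by (simp del: of_nat_add of_nat_mult of_nat_numeral)
        qed
        then show ?thesis
          by (rule has_vector_derivative_real_field)
      qed
      have "(LBINT x=ereal 0..ereal t. of_real x * (a bs * of_real x ^ (2 * d)))
        = a bs * of_real t ^ (2 * d + 2) / of_nat (2 * d + 2) - a bs * of_real 0 ^ (2 * d + 2) / of_nat (2 * d + 2)"
        by (rule interval_integral_FTC_finite) (intro continuous_intros, rule D)
      then show ?thesis
        using kernel_primitive_difference[of d "of_real t"]
        by (simp add: zero_ereal_def mult_ac flip: right_diff_distrib)
    qed
  qed
  then show ?thesis
    by blast
qed

lemma mirzakhani_primitive_exists: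
  assumes "even_poly (Suc n) v"
  shows "\<exists>A X. mirzakhani_primitive n v A X"
  using assms
proof (induction rule: even_poly_Suc_induct)
  case (monomial a d)
  then show ?case
    using mirzakhani_primitive_monomial by blast
next
  case (add f g)
  then show ?case
    using mirzakhani_primitive_add by blast
next
  case (cong f g)
  have "even_poly (Suc n) g" if "even_poly (Suc n) f"
    using that by (rule even_poly.cong) (use cong in \<open>auto simp: length_Suc_conv\<close>)
  with cong show ?case
    by (simp add: mirzakhani_primitive_def)
qed

section \<open>One step of the recursion\<close>

text \<open>Stated for an arbitrary family, because it is applied to the truncated families of the
  construction as well as to the final one.\<close>

definition volume_rhs :: "(nat \<Rightarrow> complex list \<Rightarrow> complex) \<Rightarrow> nat \<Rightarrow> real \<Rightarrow> real list \<Rightarrow> complex" where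
  "volume_rhs V g b bs =
     1/2 * (if g = 0 then 0 else
        (LINT (x, y):{(x, y). 0 \<le> x \<and> 0 \<le> y \<and> x + y \<le> b}|lborel.
           complex_of_real (x * y) * V (g - 1) (map of_real (x # y # bs))))
   + 1/2 * (\<Sum>g1\<le>g. \<Sum>I\<in>Pow {..<length bs}.
        (LINT (x, y):{(x, y). 0 \<le> x \<and> 0 \<le> y \<and> x + y \<le> b}|lborel.
           complex_of_real (x * y) * V g1 (map of_real (x # nths bs I))
             * V (g - g1) (map of_real (y # nths bs ({..<length bs} - I)))))
   + 1/2 * (\<Sum>j<length bs.
        (LBINT x=0..b + bs ! j. complex_of_real x * V g (map of_real (x # nths bs (- {j}))))
      + (LBINT x=0..b - bs ! j. complex_of_real x * V g (map of_real (x # nths bs (- {j})))))"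

text \<open>One witness \<open>W\<close> ties the recursion's right-hand side \<open>R\<close> to
  the claimed right-hand side \<open>T\<close>, and the tie survives linear combinations. The clause
  for \<open>T\<close> asks for b \<ge> 0, since for negative b the triangle is empty while the
  left-hand side continues as a polynomial.\<close>

definition realises ::
    "nat \<Rightarrow> (complex list \<Rightarrow> complex) \<Rightarrow> (real \<Rightarrow> real list \<Rightarrow> complex) \<Rightarrow> (real \<Rightarrow> real list \<Rightarrow> complex) \<Rightarrow> bool" where
  "realises n W R T \<longleftrightarrow> even_poly (Suc n) W \<and>
    (\<forall>bs b. length bs = n \<longrightarrow>
      ((\<lambda>t. of_real t * W (map of_real (t # bs))) has_vector_derivative R b bs) (at b) \<and>
      (b \<ge> 0 \<longrightarrow>
        (of_real b + 2 * pi * \<i>) * W ((of_real b + 2 * pi * \<i>) # map of_real bs)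
        - (of_real b - 2 * pi * \<i>) * W ((of_real b - 2 * pi * \<i>) # map of_real bs)
        = 4 * pi * \<i> * T b bs))"

lemma realises_zero: "realises n (\<lambda>_. 0) (\<lambda>_ _. 0) (\<lambda>_ _. 0)"
  by (simp add: realises_def even_poly.const)

lemma realises_add:
  assumes "realises n W R T" "realises n W' R' T'"
  shows "realises n (\<lambda>zs. W zs + W' zs) (\<lambda>b bs. R b bs + R' b bs) (\<lambda>b bs. T b bs + T' b bs)"
  unfolding realises_def
proof (intro conjI allI impI)
  show "even_poly (Suc n) (\<lambda>zs. W zs + W' zs)"
    using assms by (auto simp: realises_def intro: even_poly.add)
  fix bs :: "real list" and b :: real assume bs: "length bs = n"
  note * = assms[unfolded realises_def, THEN conjunct2, rule_format, OF bs, of b]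
  show "((\<lambda>t. of_real t * (W (map of_real (t # bs)) + W' (map of_real (t # bs)))) has_vector_derivative
      R b bs + R' b bs) (at b)"
    unfolding distrib_left by (intro has_vector_derivative_add *[THEN conjunct1])
  show "(of_real b + 2 * pi * \<i>) * (W ((of_real b + 2 * pi * \<i>) # map of_real bs) + W' ((of_real b + 2 * pi * \<i>) # map of_real bs))
      - (of_real b - 2 * pi * \<i>) * (W ((of_real b - 2 * pi * \<i>) # map of_real bs) + W' ((of_real b - 2 * pi * \<i>) # map of_real bs))
      = 4 * pi * \<i> * (T b bs + T' b bs)" if "b \<ge> 0"
    using *[THEN conjunct2, rule_format, OF that] unfolding distrib_left by (simp only: add_diff_add)
qed

lemma realises_scale:
  assumes "realises n W R T"
  shows "realises n (\<lambda>zs. c * W zs) (\<lambda>b bs. c * R b bs) (\<lambda>b bs. c * T b bs)"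
  unfolding realises_def
proof (intro conjI allI impI)
  show "even_poly (Suc n) (\<lambda>zs. c * W zs)"
    using assms by (auto simp: realises_def intro: even_poly.mult even_poly.const)
  fix bs :: "real list" and b :: real assume bs: "length bs = n"
  note * = assms[unfolded realises_def, THEN conjunct2, rule_format, OF bs, of b]
  show "((\<lambda>t. of_real t * (c * W (map of_real (t # bs)))) has_vector_derivative c * R b bs) (at b)"
    unfolding mult.left_commute[of _ c] by (intro has_vector_derivative_mult_right *[THEN conjunct1])
  show "(of_real b + 2 * pi * \<i>) * (c * W ((of_real b + 2 * pi * \<i>) # map of_real bs))
      - (of_real b - 2 * pi * \<i>) * (c * W ((of_real b - 2 * pi * \<i>) # map of_real bs))
      = 4 * pi * \<i> * (c * T b bs)" if "b \<ge> 0"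
    using *[THEN conjunct2, rule_format, OF that]
    unfolding mult.left_commute[of _ c] by (simp only: right_diff_distrib[symmetric])
qed

lemma realises_sum:
  assumes "finite K" "\<And>k. k \<in> K \<Longrightarrow> \<exists>W. realises n W (R k) (T k)"
  shows "\<exists>W. realises n W (\<lambda>b bs. \<Sum>k\<in>K. R k b bs) (\<lambda>b bs. \<Sum>k\<in>K. T k b bs)"
  using assms
proof (induction K rule: finite_induct)
  case empty
  then show ?case
    using realises_zero by auto
next
  case (insert k K)
  then obtain W W' where "realises n W (R k) (T k)" "realises n W' (\<lambda>b bs. \<Sum>k\<in>K. R k b bs) (\<lambda>b bs. \<Sum>k\<in>K. T k b bs)"
    by blast
  from realises_add[OF this] show ?case
    using insert.hyps by auto
qed

lemma realises_cong:
  assumes "realises n W R T"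
    and "\<And>b bs. length bs = n \<Longrightarrow> R' b bs = R b bs"
    and "\<And>b bs. length bs = n \<Longrightarrow> b \<ge> 0 \<Longrightarrow> T' b bs = T b bs"
  shows "realises n W R' T'"
  using assms unfolding realises_def by simp

lemma set_integral_iterated:
  fixes f :: "real \<times> real \<Rightarrow> complex"
  assumes "set_integrable lborel (A \<times> B) f"
  shows "(LINT x:A|lborel. LINT y:B|lborel. f (x, y)) = (LINT z:A \<times> B|lborel. f z)"
proof -
  have "integrable (lborel \<Otimes>\<^sub>M lborel) (\<lambda>z. indicator (A \<times> B) z *\<^sub>R f z)"
    using assms by (simp add: set_integrable_def lborel_prod)
  from lborel_pair.integral_fst'[OF this] show ?thesis
    by (simp add: set_lebesgue_integral_def lborel_prod indicator_times flip: scaleR_scaleR)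
qed

text \<open>Since the reduction to \<open>v\<close> is the same for both weights, the primitive of
  \<open>v\<close> has the required derivative, and its shifted difference is the triangle
  integral.\<close>

lemma realises_double:
  assumes "even_poly (Suc (Suc n)) u"
  shows "\<exists>W. realises n W
    (\<lambda>b bs. LINT x:{0..}|lborel. LINT y:{0..}|lborel.
       of_real (x * y) * u (map of_real (x # y # bs)) * of_real (mirzakhani_H (x + y) b))
    (\<lambda>b bs. LINT (x, y):{(x, y). 0 \<le> x \<and> 0 \<le> y \<and> x + y \<le> b}|lborel. of_real (x * y) * u (map of_real (x # y # bs)))"
proof -
  obtain v where v: "diagonal_reduction n u v"
    using diagonal_reduction_exists[OF assms] by blast
  then obtain A X where AX: "mirzakhani_primitive n v A X"
    using mirzakhani_primitive_exists unfolding diagonal_reduction_def by blast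
  \<comment> \<open>Setting w = 0 in the symmetric sum gives 2 A(z) = z X(z, 0, ...), so this is
    A(z) / z.\<close>
  define W where "W = (\<lambda>zs. 1 / 2 * X (hd zs # 0 # tl zs))"
  have ev_W: "even_poly (Suc n) W"
    unfolding W_def
  proof (rule even_poly.mult[OF even_poly.const even_poly_compose])
    show "even_poly (Suc (Suc n)) X"
      using AX by (simp add: mirzakhani_primitive_def)
    show "even_poly (Suc n) (\<lambda>zs. ((hd zs # 0 # tl zs) ! i)\<^sup>2)" if "i < Suc (Suc n)" for i
    proof -
      show ?thesis
      proof (cases i)
        case 0
        then show ?thesis
          by (intro even_poly.cong[OF even_poly.square[of 0]]) (auto simp: length_Suc_conv)
      next
        case (Suc k)
        show ?thesis
        proof (cases k)
          case 0
          with Suc show ?thesis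
            by (simp add: even_poly.const)
        next
          case (Suc j)
          with \<open>i = Suc k\<close> that show ?thesis
            by (intro even_poly.cong[OF even_poly.square[of "Suc j"]]) (auto simp: length_Suc_conv)
        qed
      qed
    qed
  qed simp
  have A: "A z bs = z * W (z # bs)" if "length bs = n" for z bs
  proof -
    have "A (z + 0) bs + A (z - 0) bs = z * X (z # 0 # bs)"
      by (rule AX[unfolded mirzakhani_primitive_def, THEN conjunct2, THEN conjunct2, rule_format, OF that,
            THEN conjunct1, rule_format])
    then show ?thesis
      by (simp add: W_def field_simps)
  qed
  show ?thesis
  proof (intro exI[of _ W])
    show "realises n W
    (\<lambda>b bs. LINT x:{0..}|lborel. LINT y:{0..}|lborel.
       of_real (x * y) * u (map of_real (x # y # bs)) * of_real (mirzakhani_H (x + y) b))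
    (\<lambda>b bs. LINT (x, y):{(x, y). 0 \<le> x \<and> 0 \<le> y \<and> x + y \<le> b}|lborel. of_real (x * y) * u (map of_real (x # y # bs)))"
      unfolding realises_def
    proof (intro conjI allI impI ev_W)
      fix bs :: "real list" and b :: real assume "length bs = n"
      then have bs: "length (map complex_of_real bs) = n"
        by simp
      note prim = AX[unfolded mirzakhani_primitive_def, THEN conjunct2, THEN conjunct2, rule_format, OF bs]
      note red = v[unfolded diagonal_reduction_def, THEN conjunct2, rule_format, OF _ bs]
      show "((\<lambda>t. of_real t * W (map of_real (t # bs))) has_vector_derivative
          (LINT x:{0..}|lborel. LINT y:{0..}|lborel.
             of_real (x * y) * u (map of_real (x # y # bs)) * of_real (mirzakhani_H (x + y) b))) (at b)"
      proof -
        have "(LINT x:{0..}|lborel. LINT y:{0..}|lborel.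
             of_real (x * y) * u (map of_real (x # y # bs)) * of_real (mirzakhani_H (x + y) b))
          = (LINT x:{0..}|lborel. of_real x * v (of_real x # map of_real bs) * of_real (mirzakhani_H x b))"
          using set_integral_iterated[OF red[OF moment_weight_mirzakhani_H[of b], THEN conjunct1]]
            red[OF moment_weight_mirzakhani_H[of b], THEN conjunct2]
          unfolding prod.case list.map by (simp only:)
        then show ?thesis
          using prim[THEN conjunct2, THEN conjunct1, rule_format, of 0 b]
          by (simp only: A[OF bs] list.map of_real_0 add_0_right)
      qed
      assume "b \<ge> 0"
      have "indicator {(x, y). 0 \<le> x \<and> 0 \<le> y \<and> x + y \<le> b} z *\<^sub>R (\<lambda>(x, y). of_real (x * y) * u (map of_real (x # y # bs))) z
        = indicator ({0..} \<times> {0..}) z *\<^sub>R (\<lambda>(x, y). of_real (x * y) * u (of_real x # of_real y # map of_real bs) * of_real (indicator {..b} (x + y))) z" for z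
        by (cases z) (auto simp: indicator_def)
      then have "(LINT (x, y):{(x, y). 0 \<le> x \<and> 0 \<le> y \<and> x + y \<le> b}|lborel. of_real (x * y) * u (map of_real (x # y # bs)))
        = (LBINT x=0..b. of_real x * v (of_real x # map of_real bs))"
        using red[OF moment_weight_indicator, THEN conjunct2] LINT_indicator_atMost[OF \<open>b \<ge> 0\<close>]
        unfolding set_lebesgue_integral_def by (simp only:)
      then show "(of_real b + 2 * pi * \<i>) * W ((of_real b + 2 * pi * \<i>) # map of_real bs)
        - (of_real b - 2 * pi * \<i>) * W ((of_real b - 2 * pi * \<i>) # map of_real bs)
        = 4 * pi * \<i> * (LINT (x, y):{(x, y). 0 \<le> x \<and> 0 \<le> y \<and> x + y \<le> b}|lborel. of_real (x * y) * u (map of_real (x # y # bs)))"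
        using prim[THEN conjunct2, THEN conjunct2, rule_format, of b] by (simp only: A[OF bs])
    qed
  qed
qed

section \<open>Sublists of the boundary lengths and the remaining terms\<close>

lemma nths_eq_map_nth: "nths xs I = map (\<lambda>i. xs ! i) (nths [0..<length xs] I)"
  by (metis map_nth nths_map)

lemma nths_upt_nth_less: "i < length (nths [0..<n] I) \<Longrightarrow> nths [0..<n] I ! i < n"
  using set_nths_subset[of "[0..<n]" I] nth_mem by fastforce

text \<open>Selecting a sublist only reindexes variables: \<open>nths [0..<n] I\<close> lists the
  selected positions. The offsets allow the list to start with the integration variables,
  \<open>p\<close> naming the one in use and \<open>k\<close> the start of the boundary
  lengths.\<close>

lemma even_poly_nths:
  assumes "even_poly (Suc (length (nths [0..<n] I))) f" "p < m" "k + n \<le> m"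
  shows "even_poly m (\<lambda>zs. f (zs ! p # nths (take n (drop k zs)) I))"
  using assms(1)
proof (rule even_poly_reindex[where \<sigma> = "\<lambda>i. if i = 0 then p else k + nths [0..<n] I ! (i - 1)"])
  fix zs :: "complex list" and i
  assume zs: "length zs = m"
  then have *: "nths (take n (drop k zs)) I = map (\<lambda>i. take n (drop k zs) ! i) (nths [0..<n] I)"
    using nths_eq_map_nth[of "take n (drop k zs)" I] assms(3) by simp
  show "length (zs ! p # nths (take n (drop k zs)) I) = Suc (length (nths [0..<n] I))"
    unfolding * by simp
  show "(zs ! p # nths (take n (drop k zs)) I) ! i = zs ! (if i = 0 then p else k + nths [0..<n] I ! (i - 1))"
    if "i < Suc (length (nths [0..<n] I))"
    using that nths_upt_nth_less[of "i - 1" n I] assms(3) zs unfolding * by (cases i) auto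
next
  show "(if i = 0 then p else k + nths [0..<n] I ! (i - 1)) < m" if "i < Suc (length (nths [0..<n] I))" for i
    using that nths_upt_nth_less[of "i - 1" n I] assms(2,3) by (cases i) auto
qed

lemma length_nths_remove:
  assumes "j < length xs"
  shows "length (nths xs (- {j})) = length xs - 1"
proof -
  have "{i. i < length xs \<and> i \<in> - {j}} = {..<length xs} - {j}"
    by auto
  then show ?thesis
    using assms by (simp add: length_nths)
qed

text \<open>Here w = b_j: the derivative of A(b + b_j) + A(b - b_j) meets the two H terms, and the
  symmetric sum is even in b_j, so the removed length re-enters as an even variable.\<close>

lemma realises_shift:
  assumes V: "\<And>m. even_poly m v" and j: "j < n"
  shows "\<exists>W. realises n W
    (\<lambda>b bs. LINT x:{0..}|lborel. of_real x * v (map of_real (x # nths bs (- {j})))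
       * of_real (mirzakhani_H x (b + bs ! j) + mirzakhani_H x (b - bs ! j)))
    (\<lambda>b bs. (LBINT x=0..b + bs ! j. of_real x * v (map of_real (x # nths bs (- {j}))))
       + (LBINT x=0..b - bs ! j. of_real x * v (map of_real (x # nths bs (- {j})))))"
proof -
  obtain A X where AX: "mirzakhani_primitive (n - 1) v A X"
    using mirzakhani_primitive_exists[OF V] by blast
  have len: "length (nths xs (- {j})) = n - 1" if "length xs = n" for xs :: "'b list"
    using that j by (simp add: length_nths_remove)
  \<comment> \<open>Argument 0 of \<open>X\<close> is z, argument 1 is b_j, and the rest are the
    surviving lengths; \<open>Suc\<close> accounts for z standing in front of the boundary
    lengths.\<close>
  define \<sigma> where "\<sigma> i = (if i = 0 then 0 else if i = 1 then Suc j else Suc (nths [0..<n] (- {j}) ! (i - 2)))" for i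
  define W where "W = (\<lambda>zs. X (zs ! 0 # zs ! Suc j # nths (tl zs) (- {j})))"
  have "even_poly (Suc (Suc (n - 1))) X"
    using AX by (simp add: mirzakhani_primitive_def)
  then have ev_W: "even_poly (Suc n) W"
    unfolding W_def
  proof (rule even_poly_reindex[where \<sigma> = \<sigma>])
    fix zs :: "complex list" and i
    assume zs: "length zs = Suc n"
    then have *: "nths (tl zs) (- {j}) = map (\<lambda>i. tl zs ! i) (nths [0..<n] (- {j}))"
      using nths_eq_map_nth[of "tl zs" "- {j}"] by simp
    show "length (zs ! 0 # zs ! Suc j # nths (tl zs) (- {j})) = Suc (Suc (n - 1))"
      using zs by (simp add: len)
    show "(zs ! 0 # zs ! Suc j # nths (tl zs) (- {j})) ! i = zs ! \<sigma> i" if "i < Suc (Suc (n - 1))"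
      using that nths_upt_nth_less[of "i - 2" n "- {j}"] zs unfolding * \<sigma>_def
      by (auto simp: len nth_tl nth_Cons split: nat.split)
  next
    show "\<sigma> i < Suc n" if "i < Suc (Suc (n - 1))" for i
      using that nths_upt_nth_less[of "i - 2" n "- {j}"] j by (auto simp: \<sigma>_def len)
  qed
  show ?thesis
    unfolding realises_def
  proof (intro exI[of _ W] conjI allI impI ev_W)
    fix bs :: "real list" and b :: real assume bs: "length bs = n"
    define cs where "cs = map complex_of_real (nths bs (- {j}))"
    have cs: "length cs = n - 1"
      by (simp add: cs_def len bs)
    note prim = AX[unfolded mirzakhani_primitive_def, THEN conjunct2, THEN conjunct2, rule_format, OF cs]
    have W: "z * W (z # map of_real bs) = A (z + of_real (bs ! j)) cs + A (z - of_real (bs ! j)) cs" for z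
      using prim[THEN conjunct1, rule_format, of z "of_real (bs ! j)"] j bs by (simp add: W_def cs_def nths_map)
    let ?f = "\<lambda>r x. of_real x * v (of_real x # cs) * of_real (mirzakhani_H x (b + r)) :: complex"
    have "(LINT x:{0..}|lborel. of_real x * v (map of_real (x # nths bs (- {j})))
         * of_real (mirzakhani_H x (b + bs ! j) + mirzakhani_H x (b - bs ! j)))
       = (LINT x:{0..}|lborel. ?f (bs ! j) x) + (LINT x:{0..}|lborel. ?f (- (bs ! j)) x)"
      using set_integral_add(2)[OF even_poly_weight_integrable[OF V[of "Suc (n - 1)"] moment_weight_mirzakhani_H cs]
          even_poly_weight_integrable[OF V[of "Suc (n - 1)"] moment_weight_mirzakhani_H cs], of "b + bs ! j" "b - bs ! j"]
      by (simp add: distrib_left cs_def)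
    moreover have "((\<lambda>s. A (of_real s + of_real (bs ! j)) cs + A (of_real s + of_real (- (bs ! j))) cs) has_vector_derivative
       (LINT x:{0..}|lborel. ?f (bs ! j) x) + (LINT x:{0..}|lborel. ?f (- (bs ! j)) x)) (at b)"
      by (intro has_vector_derivative_add prim[THEN conjunct2, THEN conjunct1, rule_format])
    ultimately show "((\<lambda>t. of_real t * W (map of_real (t # bs))) has_vector_derivative
       (LINT x:{0..}|lborel. of_real x * v (map of_real (x # nths bs (- {j})))
         * of_real (mirzakhani_H x (b + bs ! j) + mirzakhani_H x (b - bs ! j)))) (at b)"
      by (simp add: W)
    show "(of_real b + 2 * pi * \<i>) * W ((of_real b + 2 * pi * \<i>) # map of_real bs)
      - (of_real b - 2 * pi * \<i>) * W ((of_real b - 2 * pi * \<i>) # map of_real bs)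
      = 4 * pi * \<i> * ((LBINT x=0..b + bs ! j. of_real x * v (map of_real (x # nths bs (- {j}))))
         + (LBINT x=0..b - bs ! j. of_real x * v (map of_real (x # nths bs (- {j})))))"
      using prim[THEN conjunct2, THEN conjunct2, rule_format, of "b + bs ! j"]
        prim[THEN conjunct2, THEN conjunct2, rule_format, of "b - bs ! j"]
      unfolding W by (simp add: algebra_simps cs_def)
  qed
qed

lemma mirzakhani_step:
  assumes V: "\<And>g n. even_poly n (V g)"
  shows "\<exists>W. realises n W (mirzakhani_rhs V g) (volume_rhs V g)"
proof -
  obtain W1 where W1: "realises n W1
    (\<lambda>b bs. if g = 0 then 0 else (LINT x:{0..}|lborel. LINT y:{0..}|lborel.
       of_real (x * y) * V (g - 1) (map of_real (x # y # bs)) * of_real (mirzakhani_H (x + y) b)))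
    (\<lambda>b bs. if g = 0 then 0 else (LINT (x, y):{(x, y). 0 \<le> x \<and> 0 \<le> y \<and> x + y \<le> b}|lborel.
       of_real (x * y) * V (g - 1) (map of_real (x # y # bs))))"
    using realises_double[OF V, of n "g - 1"] realises_zero[of n] by (cases "g = 0") auto
  have split: "\<exists>W. realises n W
      (\<lambda>b bs. LINT x:{0..}|lborel. LINT y:{0..}|lborel.
           of_real (x * y) * V g1 (map of_real (x # nths bs I))
             * V (g - g1) (map of_real (y # nths bs ({..<n} - I))) * of_real (mirzakhani_H (x + y) b))
      (\<lambda>b bs. LINT (x, y):{(x, y). 0 \<le> x \<and> 0 \<le> y \<and> x + y \<le> b}|lborel.
           of_real (x * y) * V g1 (map of_real (x # nths bs I))
             * V (g - g1) (map of_real (y # nths bs ({..<n} - I))))" for g1 I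
  proof -
    \<comment> \<open>The product as one polynomial in x, y and the boundary lengths; on lists of
      length n + 2, \<open>take n (drop 2 zs)\<close> is the block of lengths.\<close>
    define u where "u = (\<lambda>zs. V g1 (zs ! 0 # nths (take n (drop 2 zs)) I)
      * V (g - g1) (zs ! 1 # nths (take n (drop 2 zs)) ({..<n} - I)))"
    have "even_poly (Suc (Suc n)) u"
      unfolding u_def by (intro even_poly.mult even_poly_nths V) auto
    then obtain W where "realises n W
      (\<lambda>b bs. LINT x:{0..}|lborel. LINT y:{0..}|lborel.
         of_real (x * y) * u (map of_real (x # y # bs)) * of_real (mirzakhani_H (x + y) b))
      (\<lambda>b bs. LINT (x, y):{(x, y). 0 \<le> x \<and> 0 \<le> y \<and> x + y \<le> b}|lborel. of_real (x * y) * u (map of_real (x # y # bs)))"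
      using realises_double by blast
    then show ?thesis
      by (intro exI[of _ W], rule realises_cong) (simp_all add: u_def nths_map mult.assoc)
  qed
  have "\<exists>W. realises n W
    (\<lambda>b bs. \<Sum>g1\<le>g. \<Sum>I\<in>Pow {..<n}. LINT x:{0..}|lborel. LINT y:{0..}|lborel.
           of_real (x * y) * V g1 (map of_real (x # nths bs I))
             * V (g - g1) (map of_real (y # nths bs ({..<n} - I))) * of_real (mirzakhani_H (x + y) b))
    (\<lambda>b bs. \<Sum>g1\<le>g. \<Sum>I\<in>Pow {..<n}. LINT (x, y):{(x, y). 0 \<le> x \<and> 0 \<le> y \<and> x + y \<le> b}|lborel.
           of_real (x * y) * V g1 (map of_real (x # nths bs I))
             * V (g - g1) (map of_real (y # nths bs ({..<n} - I))))"
    (is "\<exists>W. realises n W ?R2 ?T2")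
    by (intro realises_sum split) simp_all
  then obtain W2 where W2: "realises n W2 ?R2 ?T2" ..
  have "\<exists>W. realises n W
    (\<lambda>b bs. \<Sum>j<n. LINT x:{0..}|lborel. of_real x * V g (map of_real (x # nths bs (- {j})))
       * of_real (mirzakhani_H x (b + bs ! j) + mirzakhani_H x (b - bs ! j)))
    (\<lambda>b bs. \<Sum>j<n. (LBINT x=0..b + bs ! j. of_real x * V g (map of_real (x # nths bs (- {j}))))
       + (LBINT x=0..b - bs ! j. of_real x * V g (map of_real (x # nths bs (- {j})))))"
    (is "\<exists>W. realises n W ?R3 ?T3")
    by (intro realises_sum realises_shift[OF V]) simp_all
  then obtain W3 where W3: "realises n W3 ?R3 ?T3" ..
  have "realises n (\<lambda>zs. 1 / 2 * W1 zs + 1 / 2 * W2 zs + 1 / 2 * W3 zs) (mirzakhani_rhs V g) (volume_rhs V g)"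
    by (rule realises_cong[OF realises_add[OF realises_add[OF realises_scale[OF W1] realises_scale[OF W2]] realises_scale[OF W3]]])
      (simp_all add: mirzakhani_rhs_def volume_rhs_def)
  then show ?thesis
    by blast
qed

section \<open>Existence and uniqueness of the family\<close>

text \<open>The derivative fixes t f(t) up to a constant, and the constant is settled by the value 0
  at t = 0. Dividing by t gives equality at positive lengths, and the identity theorem does the
  rest.\<close>

lemma recursion_unique:
  assumes f: "polynomial_in (Suc n) f" and g: "polynomial_in (Suc n) g"
    and df: "\<And>bs b. length bs = n \<Longrightarrow> \<forall>x\<in>set bs. x \<ge> 0 \<Longrightarrow> b \<ge> 0 \<Longrightarrow>
      ((\<lambda>t. of_real t * f (map of_real (t # bs))) has_vector_derivative R b bs) (at b within {0..})"
    and dg: "\<And>bs b. length bs = n \<Longrightarrow> \<forall>x\<in>set bs. x \<ge> 0 \<Longrightarrow> b \<ge> 0 \<Longrightarrow>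
      ((\<lambda>t. of_real t * g (map of_real (t # bs))) has_vector_derivative R b bs) (at b within {0..})"
    and len: "length zs = Suc n"
  shows "f zs = g zs"
proof (rule polynomial_in_eqI[OF f g _ len])
  fix xs :: "real list"
  assume xs: "length xs = Suc n" "\<forall>x\<in>set xs. x > 0"
  then obtain t bs where xs_eq: "xs = t # bs" and bs: "length bs = n" "\<forall>x\<in>set bs. x \<ge> 0" and t: "t > 0"
    by (auto simp: length_Suc_conv less_imp_le)
  let ?d = "\<lambda>t. of_real t * f (map of_real (t # bs)) - of_real t * g (map of_real (t # bs))"
  have "(?d has_vector_derivative 0) (at s within {0..})" if "s \<in> {0..}" for s
    using has_vector_derivative_diff[OF df dg, of bs s bs] bs that by simp
  then obtain c where c: "\<And>s. s \<in> {0..} \<Longrightarrow> ?d s = c"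
    by (rule has_vector_derivative_zero_constant[OF convex_real_interval(1)]) auto
  have "?d t = ?d 0"
    using c[of t] c[of 0] t by simp
  then show "f (map of_real xs) = g (map of_real xs)"
    using t by (simp add: xs_eq)
qed

text \<open>This makes the recursion well-founded in 2g + n. In the product terms the complexities
  of the two factors add up to one more than that of the left-hand side, so a factor that is not of
  lower complexity is paired with one of complexity at most 1, which is unstable and
  vanishes.\<close>

lemma mirzakhani_rhs_cong:
  assumes eq: "\<And>g' zs. 2 * g' + length zs < 2 * g + Suc (length bs) \<Longrightarrow> V g' zs = W g' zs"
    and unstable: "\<And>g' zs. 2 * g' + length zs \<le> 1 \<Longrightarrow> V g' zs = 0"
      "\<And>g' zs. 2 * g' + length zs \<le> 1 \<Longrightarrow> W g' zs = 0"
  shows "mirzakhani_rhs V g b bs = mirzakhani_rhs W g b bs"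
proof -
  define n where "n = length bs"
  have prod: "V g1 (map of_real (x # nths bs I)) * V (g - g1) (map of_real (y # nths bs ({..<n} - I)))
      = W g1 (map of_real (x # nths bs I)) * W (g - g1) (map of_real (y # nths bs ({..<n} - I)))"
    if "g1 \<le> g" "I \<in> Pow {..<n}" for g1 I x y
  proof -
    have "length (nths bs I) = card I"
      using that by (auto simp: length_nths n_def intro!: arg_cong[of _ _ card])
    moreover have "length (nths bs ({..<n} - I)) = n - card I"
    proof -
      have "{i. i < length bs \<and> i \<in> {..<n} - I} = {..<n} - I"
        by (auto simp: n_def)
      then show ?thesis
        using that by (simp add: length_nths card_Diff_subset finite_subset)
    qed
    moreover have "card I \<le> n"
      using that card_mono[of "{..<n}" I] by auto
    ultimately have size: "2 * g1 + length (map complex_of_real (x # nths bs I))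
      + (2 * (g - g1) + length (map complex_of_real (y # nths bs ({..<n} - I)))) = 2 * g + Suc (length bs) + 1"
      using that by (simp add: n_def)
    consider "2 * g1 + length (map complex_of_real (x # nths bs I)) \<le> 1"
      | "2 * (g - g1) + length (map complex_of_real (y # nths bs ({..<n} - I))) \<le> 1"
      | "2 * g1 + length (map complex_of_real (x # nths bs I)) < 2 * g + Suc (length bs)"
        "2 * (g - g1) + length (map complex_of_real (y # nths bs ({..<n} - I))) < 2 * g + Suc (length bs)"
      using size by linarith
    then show ?thesis
      by cases (simp_all only: eq unstable mult_zero_left mult_zero_right)
  qed
  have 1: "V (g - 1) (map of_real (x # y # bs)) = W (g - 1) (map of_real (x # y # bs))" if "g \<noteq> 0" for x y
    using that by (intro eq) simp
  have 3: "V g (map of_real (x # nths bs (- {j}))) = W g (map of_real (x # nths bs (- {j})))" if "j < n" for j x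
    using that by (intro eq) (simp add: length_nths_remove n_def)
  show ?thesis
    unfolding mirzakhani_rhs_def n_def[symmetric]
    using 1 3 by (intro arg_cong2[of _ _ _ _ "(+)"] arg_cong2[of _ _ _ _ "(*)"] refl sum.cong)
      (auto simp: prod mult.assoc simp del: list.map)
qed

section \<open>Construction of the family level by level\<close>

text \<open>A choice, because a witness is free on lists of length other than n + 1;
  \<open>volume_level\<close> evaluates it only at length n + 1.\<close>

definition recursion_step :: "(nat \<Rightarrow> complex list \<Rightarrow> complex) \<Rightarrow> nat \<Rightarrow> nat \<Rightarrow> complex list \<Rightarrow> complex" where
  "recursion_step V g n = (SOME W. realises n W (mirzakhani_rhs V g) (volume_rhs V g))"

text \<open>The number \<open>2 g + n\<close> plays the role of \<open>2 g - 2 + n\<close>: level \<open>k\<close> is correct for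
  \<open>2 g + n \<le> k + 3\<close> and zero beyond.\<close>

primrec volume_level :: "nat \<Rightarrow> nat \<Rightarrow> complex list \<Rightarrow> complex" where
  "volume_level 0 g zs = (if zs \<noteq> [] \<and> 2 * g + length zs = 3
     then if g = 0 then 1 else ((zs ! 0)\<^sup>2 + 4 * of_real pi ^ 2) / 48 else 0)"
| "volume_level (Suc k) g zs = (if zs \<noteq> [] \<and> 2 * g + length zs = k + 4
     then recursion_step (volume_level k) g (length zs - 1) zs else volume_level k g zs)"

text \<open>Level 2g + n lies safely above 2g + n - 3, from which point on the value is
  stable.\<close>

definition wp_poly :: "nat \<Rightarrow> complex list \<Rightarrow> complex" where
  "wp_poly g zs = volume_level (2 * g + length zs) g zs"

lemma even_poly_volume_level: "even_poly n (volume_level k g)"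
proof (induction k arbitrary: g n)
  case 0
  have "n = 3 \<and> g = 0 \<or> n = 1 \<and> g = 1 \<or> n = 0 \<or> 2 * g + n \<noteq> 3"
    by presburger
  then consider "n = 3" "g = 0" | "n = 1" "g = 1" | "n = 0 \<or> 2 * g + n \<noteq> 3"
    by blast
  then show ?case
  proof cases
    case 1
    then show ?thesis
      by (intro even_poly.cong[OF even_poly.const[of n 1]]) auto
  next
    case 2
    have "even_poly n (\<lambda>zs. ((zs ! 0)\<^sup>2 + 4 * of_real pi ^ 2) * (1 / 48))"
      using 2 by (intro even_poly_intros) simp
    then show ?thesis
      by (rule even_poly.cong) (use 2 in auto)
  next
    case 3
    then show ?thesis
      by (intro even_poly.cong[OF even_poly.const[of n 0]]) auto
  qed
next
  case (Suc k)
  show ?case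
  proof (cases "n \<noteq> 0 \<and> 2 * g + n = k + 4")
    case True
    have "realises (n - 1) (recursion_step (volume_level k) g (n - 1))
        (mirzakhani_rhs (volume_level k) g) (volume_rhs (volume_level k) g)"
      unfolding recursion_step_def using mirzakhani_step[of "volume_level k", OF Suc.IH] by (rule someI_ex)
    then have "even_poly n (recursion_step (volume_level k) g (n - 1))"
      using True by (simp add: realises_def)
    then show ?thesis
      by (rule even_poly.cong) (use True in auto)
  next
    case False
    show ?thesis
      by (rule even_poly.cong[OF Suc.IH[of n g]]) (use False in auto)
  qed
qed

lemma volume_level_stable: "2 * g + length zs \<le> k + 3 \<Longrightarrow> volume_level (k + j) g zs = volume_level k g zs"
  by (induction j) auto

lemma volume_level_eq_volume:
  assumes "2 * g + length zs \<le> k + 3"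
  shows "volume_level k g zs = wp_poly g zs"
proof (cases "k \<le> 2 * g + length zs")
  case True
  then show ?thesis
    using volume_level_stable[OF assms, of "2 * g + length zs - k"] by (simp add: wp_poly_def)
next
  case False
  then show ?thesis
    using volume_level_stable[of g zs "2 * g + length zs" "k - (2 * g + length zs)"] by (simp add: wp_poly_def)
qed

lemma volume_level_unstable: "zs = [] \<or> 2 * g + length zs \<le> 2 \<Longrightarrow> volume_level k g zs = 0"
  by (induction k) auto

lemma volume_unstable: "zs = [] \<or> 2 * g + length zs \<le> 2 \<Longrightarrow> wp_poly g zs = 0"
  unfolding wp_poly_def by (rule volume_level_unstable)

lemma even_poly_volume: "even_poly n (wp_poly g)"
  by (rule even_poly.cong[OF even_poly_volume_level[of n "2 * g + n" g]]) (simp add: wp_poly_def)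

lemma volume_recursion:
  assumes "2 * g + Suc (length bs) \<ge> 4"
  shows "((\<lambda>t. of_real t * wp_poly g (map of_real (t # bs))) has_vector_derivative mirzakhani_rhs wp_poly g b bs) (at b)"
proof -
  \<comment> \<open>Level \<open>Suc k\<close> is the first to define complexity k + 4, while the
    right-hand side involves complexities up to k + 3, on which level \<open>k\<close> is already
    final.\<close>
  define k where "k = 2 * g + Suc (length bs) - 4"
  have k: "2 * g + Suc (length bs) = k + 4"
    using assms by (simp add: k_def)
  define W where "W = recursion_step (volume_level k) g (length bs)"
  have "realises (length bs) W (mirzakhani_rhs (volume_level k) g) (volume_rhs (volume_level k) g)"
    unfolding W_def recursion_step_def
    using mirzakhani_step[of "volume_level k", OF even_poly_volume_level] by (rule someI_ex)
  then have "((\<lambda>t. of_real t * W (map of_real (t # bs))) has_vector_derivative mirzakhani_rhs (volume_level k) g b bs) (at b)"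
    by (simp add: realises_def)
  moreover have "mirzakhani_rhs (volume_level k) g b bs = mirzakhani_rhs wp_poly g b bs"
    using k by (intro mirzakhani_rhs_cong volume_level_eq_volume volume_unstable volume_level_unstable) auto
  moreover have "W (map of_real (t # bs)) = wp_poly g (map of_real (t # bs))" for t
  proof -
    have "wp_poly g (map of_real (t # bs)) = volume_level (Suc k) g (map of_real (t # bs))"
      using k by (intro volume_level_eq_volume[symmetric]) simp
    then show ?thesis
      using k by (simp add: W_def)
  qed
  ultimately show ?thesis
    by simp
qed

lemma weil_petersson_family_volume: "weil_petersson_family wp_poly"
  unfolding weil_petersson_family_def
proof (intro conjI allI impI)
  show "wp_poly g zs = 0" if "zs = [] \<or> 2 * int g - 2 + int (length zs) \<le> 0" for g zs
    using that by (intro volume_unstable) auto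
  show "polynomial_in n (wp_poly g)" "even_in_each_variable n (wp_poly g)" for g n
    by (intro even_poly_imp_polynomial_in even_poly_imp_even even_poly_volume)+
  show "wp_poly 0 [z1, z2, z3] = 1" for z1 z2 z3
    by (subst volume_level_eq_volume[symmetric, where k = 0]) simp_all
  show "wp_poly 1 [z] = (z\<^sup>2 + 4 * of_real pi ^ 2) / 48" for z
    by (subst volume_level_eq_volume[symmetric, where k = 0]) simp_all
  show "((\<lambda>t. of_real t * wp_poly g (map of_real (t # bs))) has_vector_derivative mirzakhani_rhs wp_poly g b bs) (at b within {0..})"
    if "2 \<le> 2 * int g - 2 + int (length (b # bs))" for g b bs
    using that by (intro has_vector_derivative_at_within[OF volume_recursion]) simp
qed

text \<open>Strong induction on 2g + n: below 4 the values are prescribed, and from 4 on both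
  families solve the same recursion because their right-hand sides involve only smaller
  complexities.\<close>

lemma weil_petersson_family_unique:
  assumes V: "weil_petersson_family V" and W: "weil_petersson_family W"
  shows "V = W"
proof -
  have unstable: "U g zs = 0" if "weil_petersson_family U" "2 * g + length zs \<le> 2" for U g zs
    using that by (auto simp: weil_petersson_family_def)
  have "V g zs = W g zs" for g zs
  proof (induction "2 * g + length zs" arbitrary: g zs rule: less_induct)
    case less
    consider "zs = [] \<or> 2 * g + length zs \<le> 2" | "g = 0" "length zs = 3" | "g = 1" "length zs = 1"
      | n where "length zs = Suc n" "2 * g + Suc n \<ge> 4"
    proof -
      have "2 * g + m \<le> 2 \<or> g = 0 \<and> m = 3 \<or> g = 1 \<and> m = 1 \<or> 2 * g + m \<ge> 4" if "m \<noteq> 0" for m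
        using that by presburger
      from this[of "length zs"] show ?thesis
        using that by (cases zs) auto
    qed
    then show ?case
    proof cases
      case 1
      then have "zs = [] \<or> 2 * int g - 2 + int (length zs) \<le> 0"
        by auto
      then show ?thesis
        using V W unfolding weil_petersson_family_def by metis
    next
      case 2
      then obtain z1 z2 z3 where "zs = [z1, z2, z3]"
        by (auto simp: eval_nat_numeral length_Suc_conv)
      moreover have "U 0 [z1, z2, z3] = 1" if "weil_petersson_family U" for U
        using that unfolding weil_petersson_family_def by blast
      ultimately show ?thesis
        using 2 V W by metis
    next
      case 3
      then obtain z where "zs = [z]"
        by (auto simp: length_Suc_conv)
      moreover have "U 1 [z] = (z\<^sup>2 + 4 * of_real pi ^ 2) / 48" if "weil_petersson_family U" for U
        using that unfolding weil_petersson_family_def by blast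
      ultimately show ?thesis
        using 3 V W by metis
    next
      case (4 n)
      have rhs: "mirzakhani_rhs W g b bs = mirzakhani_rhs V g b bs" if "length bs = n" for b bs
        using that 4 by (intro mirzakhani_rhs_cong less.hyps[symmetric] unstable V W) auto
      have deriv: "((\<lambda>t. of_real t * U g (map of_real (t # bs))) has_vector_derivative mirzakhani_rhs U g b bs) (at b within {0..})"
        if "weil_petersson_family U" "length bs = n" "\<forall>x\<in>set bs. x \<ge> 0" "b \<ge> 0" for U bs b
      proof -
        have "2 \<le> 2 * int g - 2 + int (length (b # bs))"
          using that 4 by simp
        then show ?thesis
          using that unfolding weil_petersson_family_def by blast
      qed
      show ?thesis
      proof (rule recursion_unique[where R = "mirzakhani_rhs V g"])
        show "polynomial_in (Suc n) (V g)" "polynomial_in (Suc n) (W g)"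
          using V W by (simp_all add: weil_petersson_family_def)
        show "((\<lambda>t. of_real t * W g (map of_real (t # bs))) has_vector_derivative mirzakhani_rhs V g b bs) (at b within {0..})"
          if "length bs = n" "\<forall>x\<in>set bs. x \<ge> 0" "b \<ge> 0" for bs b
          using deriv[OF W that] rhs[OF that(1)] by simp
      qed (use deriv[OF V] 4 in auto)
    qed
  qed
  then show ?thesis
    by blast
qed

lemma WP_volume_eq: "WP_volume = wp_poly"
  unfolding WP_volume_def
  by (intro the_equality weil_petersson_family_volume weil_petersson_family_unique)

theorem theorem1p2:
  fixes g n :: nat and b :: real and bs :: "real list"
  assumes "n \<ge> 1" and "2 * int g - 2 + int n \<ge> 2"
    and "b \<ge> 0" and "length bs = n - 1" and "\<forall>x\<in>set bs. x \<ge> 0"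
  shows
    "1 / (4 * of_real pi * \<i>) *
       ((of_real b + 2 * of_real pi * \<i>)
            * WP_volume g ((of_real b + 2 * of_real pi * \<i>) # map of_real bs)
        - (of_real b - 2 * of_real pi * \<i>)
            * WP_volume g ((of_real b - 2 * of_real pi * \<i>) # map of_real bs))
     = 1/2 * (if g = 0 then 0 else
          (LINT (x, y):{(x, y). 0 \<le> x \<and> 0 \<le> y \<and> x + y \<le> b}|lborel.
             complex_of_real (x * y) * WP_volume (g - 1) (map of_real (x # y # bs))))
     + 1/2 * (\<Sum>g1\<le>g. \<Sum>I\<in>Pow {..<n - 1}.
          (LINT (x, y):{(x, y). 0 \<le> x \<and> 0 \<le> y \<and> x + y \<le> b}|lborel.
             complex_of_real (x * y) * WP_volume g1 (map of_real (x # nths bs I))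
               * WP_volume (g - g1) (map of_real (y # nths bs ({..<n - 1} - I)))))
     + 1/2 * (\<Sum>j<n - 1.
          (LBINT x=0..b + bs ! j.
             complex_of_real x * WP_volume g (map of_real (x # nths bs (- {j}))))
        + (LBINT x=0..b - bs ! j.
             complex_of_real x * WP_volume g (map of_real (x # nths bs (- {j})))))"
proof -
  \<comment> \<open>\<open>W\<close> comes with the shifted difference, \<open>wp_poly\<close> with
    the recursion; both have the same derivative, so uniqueness transfers the difference to
    \<open>wp_poly\<close>.\<close>
  obtain W where W: "realises (n - 1) W (mirzakhani_rhs wp_poly g) (volume_rhs wp_poly g)"
    using mirzakhani_step[of wp_poly, OF even_poly_volume] by blast
  have size: "2 * g + Suc (n - 1) \<ge> 4"
    using assms(1,2) by linarith
  have "W zs = wp_poly g zs" if "length zs = Suc (n - 1)" for zs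
  proof (rule recursion_unique[OF _ _ _ _ that])
    show "polynomial_in (Suc (n - 1)) W" "polynomial_in (Suc (n - 1)) (wp_poly g)"
      by (intro even_poly_imp_polynomial_in even_poly_volume W[unfolded realises_def, THEN conjunct1])+
    show "((\<lambda>t. of_real t * W (map of_real (t # bs))) has_vector_derivative mirzakhani_rhs wp_poly g b bs) (at b within {0..})"
      if "length bs = n - 1" for bs b
      using W[unfolded realises_def, THEN conjunct2, rule_format, OF that, THEN conjunct1]
      by (rule has_vector_derivative_at_within)
    show "((\<lambda>t. of_real t * wp_poly g (map of_real (t # bs))) has_vector_derivative mirzakhani_rhs wp_poly g b bs) (at b within {0..})"
      if "length bs = n - 1" for bs b
      using size that by (intro has_vector_derivative_at_within[OF volume_recursion]) simp
  qed
  then have "(of_real b + 2 * pi * \<i>) * wp_poly g ((of_real b + 2 * pi * \<i>) # map of_real bs)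
      - (of_real b - 2 * pi * \<i>) * wp_poly g ((of_real b - 2 * pi * \<i>) # map of_real bs)
      = 4 * pi * \<i> * volume_rhs wp_poly g b bs"
    using W[unfolded realises_def, THEN conjunct2, rule_format, OF assms(4), THEN conjunct2, rule_format, OF assms(3)]
      assms(4) by simp
  moreover have "1 / c * (c * R) = R" if "c \<noteq> 0" for c R :: complex
    using that by simp
  ultimately have "1 / (4 * of_real pi * \<i>) *
       ((of_real b + 2 * of_real pi * \<i>) * wp_poly g ((of_real b + 2 * of_real pi * \<i>) # map of_real bs)
        - (of_real b - 2 * of_real pi * \<i>) * wp_poly g ((of_real b - 2 * of_real pi * \<i>) # map of_real bs))
     = volume_rhs wp_poly g b bs"
    by (simp only: of_real_mult of_real_numeral) simp
  then show ?thesis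
    unfolding WP_volume_eq volume_rhs_def assms(4) .
qed

end
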